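(* Let $\lambda_1,\lambda_2>0$ and $\mu_2\ge 0$. Let $\mathbf d=(\mathbf d_t)_{t\in\mathbb N}$ be the discrete-time in-degree Markov chain with parameters $\lambda_1,\lambda_2,\mu_2$, let $\hat Z=(\hat Z_u)_{u\ge 0}$ be the continuous-time $S$-valued process given by the generalized Yule model with detachment with parameters $\lambda_1,\lambda_2,\mu_2$, and let $(\hat\tau_t)_{t\in\mathbb N}$ be the associated sequence of census times (all as defined in the context). Then the processes $(\hat Z_{\hat\tau_t})_{t\in\mathbb N}$ and $(\mathbf d_t)_{t\in\mathbb N}$ have the same distribution.
   Context: $\mathbb N=\{0,1,2,\dots\}$. State space: $S:=\bigcup_{n\ge 1}\mathbb N^n$. For $\mathbf x=(x^1,\dots,x^n)\in\mathbb N^n\subset S$ write $\ell(\mathbf x):=n$ (the length) and $\|\mathbf x\|:=\sum_{j=1}^{\ell(\mathbf x)}x^j$. The in-degree chain with parameters $\lambda_1,\lambda_2>0$, $\mu_2\ge0$: $\mathbf d=(\mathbf d_t)_{t\in\mathbb N}$, $\mathbf d_t=(d_t^1,\dots,d_t^{\ell(\mathbf d_t)})$, is the discrete-time Markov chain on $S$, on a probability space $(\Omega,\mathcal F,\mathbb P)$, with $\mathbf d_0=(1)$ (the sequence of length one with entry $1$) and the following transition probabilities $p_{\mathbf x,\mathbf y}$. Put $D(\mathbf x)=(\lambda_2+\mu_2)\|\mathbf x\|+\ell(\mathbf x)\lambda_1$. From $\mathbf x\in S$ the chain moves - to $(x^1,\dots,x^{i-1},x^i+1,x^{i+1},\dots,x^{\ell(\mathbf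 x)})$ with probability $x^i\lambda_2/D(\mathbf x)$, for each $1\le i\le\ell(\mathbf x)$; - to $(x^1,\dots,x^{i-1},x^i-1,x^{i+1},\dots,x^{\ell(\mathbf x)})$ with probability $x^i\mu_2/D(\mathbf x)$, for each $1\le i\le\ell(\mathbf x)$ (this is $0$ when $x^i=0$); - to $(x^1,\dots,x^{\ell(\mathbf x)},1)$ with probability $\ell(\mathbf x)\lambda_1/D(\mathbf x)$; all other transitions have probability $0$. A birth-death process with birth rate $\lambda>0$ and death rate $\mu\ge0$ is a continuous-time (right-continuous) Markov chain on $\mathbb N$ with infinitesimal generator $(a_{ij})$, $a_{ii}=-i(\lambda+\mu)$, $a_{i,i+1}=i\lambda$, $a_{i,i-1}=i\mu$, $a_{ij}=0$ otherwise; it starts at one if its value at time $0$ is $1$. If $\mu=0$ it is a pure birth process with rate $\lambda$. Generalized Yule model with detachment with parameters $\lambda_1,\lambda_2,\mu_2$: on a probability space $(\hat\Omega,\hat{\mathcal F},\hat{\mathbb P})$ let $Z^{(1)},Z^{(2)},\dots$ be independent birth-death processes with birth rate $\lambda_2$ and death rate $\mu_2$, each starting at one, and let $\pi_1,\pi_2,\dots$ be independent random variables, independent of all $Z^{(j)}$, with $\pi_k$ exponentially distributed with parameter $k\lambda_1$. Put $T_0=0$ and $T_k=\pi_1+\dots+\pi_k$ (formation times of new households; they are the jump times of a pure birth process with rate $\lambda_1$ starting at one). For $T_{n-1}\le u<T_n$, $n\ge1$, set $\ell(\hat Z_u)=n$ and $$\hat Z_u=(\hat Z_u^1,\dots,\hat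 Z_u^n),\qquad \hat Z_u^j=Z^{(j)}_{u-T_{j-1}},\ 1\le j\le n.$$ Thus $\hat Z_0=(1)$, $\ell(\hat Z_u)$ is the number of households at time $u$ and $\hat Z_u^j$ is the size of the $j$-th household. Census times: $\hat\tau_0=0$, and $\hat\tau_1<\hat\tau_2<\dots$ are the successive jump times of the $S$-valued process $\hat Z$, i.e. $\hat\tau_{t+1}$ is the first time after $\hat\tau_t$ at which a birth or a death in one of the existing households, or the formation of a new household, occurs. *)

theory Defs
  imports "HOL-Probability.Probability"
begin

definition states :: "nat list set" where
  "states = {x. x \<noteq> []}"

definition total_rate :: "real \<Rightarrow> real \<Rightarrow> real \<Rightarrow> nat list \<Rightarrow> real" where
  "total_rate l1 l2 m2 x = (l2 + m2) * real (sum_list x) + real (length x) * l1"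

text \<open>
  The three kinds of targets, and the targets for different positions whose weight is nonzero,
  are pairwise distinct, so at most one summand is nonzero. The truncation in
  \<^term>\<open>x ! i - 1\<close> only occurs with weight \<open>0\<close>.
\<close>

definition in_degree_prob :: "real \<Rightarrow> real \<Rightarrow> real \<Rightarrow> nat list \<Rightarrow> nat list \<Rightarrow> real" where
  "in_degree_prob l1 l2 m2 x y =
     (\<Sum>i<length x. of_bool (y = x[i := x ! i + 1]) * (real (x ! i) * l2 / total_rate l1 l2 m2 x)) +
     (\<Sum>i<length x. of_bool (y = x[i := x ! i - 1]) * (real (x ! i) * m2 / total_rate l1 l2 m2 x)) +
     of_bool (y = x @ [1]) * (real (length x) * l1 / total_rate l1 l2 m2 x)"

locale in_degree_chain = prob_space M for M :: "'a measure" +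
  fixes l1 l2 m2 :: real and d :: "nat \<Rightarrow> 'a \<Rightarrow> nat list"
  assumes measurable_d: "\<And>t. d t \<in> M \<rightarrow>\<^sub>M count_space states"
    and start: "AE \<omega> in M. d 0 \<omega> = [1]"
    and markov: "\<And>t x y. y \<in> states \<Longrightarrow> \<P>(\<omega> in M. \<forall>k\<le>t. d k \<omega> = x k) > 0 \<Longrightarrow>
      \<P>(\<omega> in M. d (Suc t) \<omega> = y \<bar> \<forall>k\<le>t. d k \<omega> = x k) = in_degree_prob l1 l2 m2 (x t) y"

definition transition_function :: "(real \<Rightarrow> nat \<Rightarrow> nat \<Rightarrow> real) \<Rightarrow> bool" where
  "transition_function p \<longleftrightarrow>
     (\<forall>t\<ge>0. \<forall>i j. p t i j \<ge> 0) \<and>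
     (\<forall>t\<ge>0. \<forall>i. (\<lambda>j. p t i j) sums 1) \<and>
     (\<forall>i j. p 0 i j = of_bool (i = j)) \<and>
     (\<forall>s\<ge>0. \<forall>t\<ge>0. \<forall>i k. (\<lambda>j. p s i j * p t j k) sums p (s + t) i k)"

definition infinitesimal_generator ::
    "(real \<Rightarrow> nat \<Rightarrow> nat \<Rightarrow> real) \<Rightarrow> (nat \<Rightarrow> nat \<Rightarrow> real) \<Rightarrow> bool" where
  "infinitesimal_generator p a \<longleftrightarrow>
     (\<forall>i j. ((\<lambda>t. p t i j) has_real_derivative a i j) (at_right 0))"

definition birth_death_generator :: "real \<Rightarrow> real \<Rightarrow> nat \<Rightarrow> nat \<Rightarrow> real" where
  "birth_death_generator l m i j =
     (if j = i then - real i * (l + m)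
      else if j = i + 1 then real i * l
      else if j + 1 = i then real i * m
      else 0)"

locale right_continuous_markov_chain = prob_space M for M :: "'a measure" +
  fixes a :: "nat \<Rightarrow> nat \<Rightarrow> real" and X :: "real \<Rightarrow> 'a \<Rightarrow> nat"
  assumes measurable_X: "\<And>t. t \<ge> 0 \<Longrightarrow> X t \<in> M \<rightarrow>\<^sub>M count_space UNIV"
    and right_continuous:
      "\<And>\<omega> t. \<omega> \<in> space M \<Longrightarrow> t \<ge> 0 \<Longrightarrow> continuous (at_right t) (\<lambda>s. X s \<omega>)"
    and markov: "\<exists>p. transition_function p \<and> infinitesimal_generator p a \<and>
      (\<forall>n (t :: nat \<Rightarrow> real) (x :: nat \<Rightarrow> nat) y.
         0 \<le> t 0 \<and> (\<forall>k\<le>n. t k < t (Suc k)) \<and> \<P>(\<omega> in M. \<forall>k\<le>n. X (t k) \<omega> = x k) > 0 \<longrightarrow>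
         \<P>(\<omega> in M. X (t (Suc n)) \<omega> = y \<bar> \<forall>k\<le>n. X (t k) \<omega> = x k) =
           p (t (Suc n) - t n) (x n) y)"

locale birth_death_process_from_one =
  right_continuous_markov_chain M "birth_death_generator l m" X
  for M :: "'a measure" and l m :: real and X :: "real \<Rightarrow> 'a \<Rightarrow> nat" +
  assumes start: "AE \<omega> in M. X 0 \<omega> = 1"

text \<open>The families \<open>Z\<close> and \<open>\<pi>\<close> are indexed from \<open>1\<close>; their values at \<open>0\<close> are irrelevant.\<close>

locale yule_detachment = prob_space M for M :: "'a measure" +
  fixes l1 l2 m2 :: real
    and Z :: "nat \<Rightarrow> real \<Rightarrow> 'a \<Rightarrow> nat"
    and \<pi> :: "nat \<Rightarrow> 'a \<Rightarrow> real"
  assumes birth_death: "\<And>j. j \<ge> 1 \<Longrightarrow> birth_death_process_from_one M l2 m2 (Z j)"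
    and exponential:
      "\<And>k. k \<ge> 1 \<Longrightarrow> distributed M lborel (\<pi> k) (exponential_density (real k * l1))"
    and indep_Z: "indep_vars (\<lambda>_. \<Pi>\<^sub>M u\<in>{0..}. count_space UNIV) (\<lambda>j \<omega>. \<lambda>u\<in>{0..}. Z j u \<omega>) {1..}"
    and indep_\<pi>: "indep_vars (\<lambda>_. borel) \<pi> {1..}"
    and indep_Z_\<pi>: "indep_set
      (sets (vimage_algebra (space M) (\<lambda>\<omega>. \<lambda>j\<in>{1..}. \<lambda>u\<in>{0..}. Z j u \<omega>)
        (\<Pi>\<^sub>M j\<in>{1..}. \<Pi>\<^sub>M u\<in>{0..}. count_space UNIV)))
      (sets (vimage_algebra (space M) (\<lambda>\<omega>. \<lambda>k\<in>{1..}. \<pi> k \<omega>)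
        (\<Pi>\<^sub>M k\<in>{1..}. borel)))"

definition formation_time :: "(nat \<Rightarrow> 'a \<Rightarrow> real) \<Rightarrow> nat \<Rightarrow> 'a \<Rightarrow> real" where
  "formation_time \<pi> k \<omega> = (\<Sum>i=1..k. \<pi> i \<omega>)"

text \<open>
  Almost surely the formation times increase strictly to infinity, and then the number of
  households at time \<open>u \<ge> 0\<close> is the unique \<open>n \<ge> 1\<close> with \<open>T\<^sub>n\<^sub>-\<^sub>1 \<le> u < T\<^sub>n\<close>.
\<close>

definition households :: "(nat \<Rightarrow> 'a \<Rightarrow> real) \<Rightarrow> real \<Rightarrow> 'a \<Rightarrow> nat" where
  "households \<pi> u \<omega> =
     Suc (LEAST m. formation_time \<pi> m \<omega> \<le> u \<and> u < formation_time \<pi> (Suc m) \<omega>)"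

definition yule_process ::
    "(nat \<Rightarrow> real \<Rightarrow> 'a \<Rightarrow> nat) \<Rightarrow> (nat \<Rightarrow> 'a \<Rightarrow> real) \<Rightarrow> real \<Rightarrow> 'a \<Rightarrow> nat list" where
  "yule_process Z \<pi> u \<omega> =
     map (\<lambda>j. Z j (u - formation_time \<pi> (j - 1) \<omega>) \<omega>) [1..<Suc (households \<pi> u \<omega>)]"

text \<open>
  For a right-continuous path in a discrete space the infimum is attained. The \<open>else\<close> branch
  (no further jump) has probability \<open>0\<close> for the Yule model, since new households keep forming.
\<close>

primrec jump_time :: "(real \<Rightarrow> 'a \<Rightarrow> 's) \<Rightarrow> nat \<Rightarrow> 'a \<Rightarrow> real" where
  "jump_time X 0 \<omega> = 0"
| "jump_time X (Suc t) \<omega> =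
     (let c = jump_time X t \<omega>; J = {u. u > c \<and> X u \<omega> \<noteq> X c \<omega>}
      in if J = {} then c else Inf J)"

end

theory Submission
  imports Defs
begin

text \<open>
  Round every formation time up to a grid of mesh \<open>h\<close> and look at the households at grid times only.
  By independence and the memoryless property of the \<open>\<pi> k\<close>, the probability that this skeleton
  follows a given path is at least a product of one-step weights, whose rates at \<open>h = 0\<close> are those
  of the in-degree chain before normalisation. Summing geometric series over the holding times and
  letting \<open>h\<close> tend to \<open>0\<close> bounds the probability that the census chain starts with a given list
  of states from below by the probability that the in-degree chain does. Both are probability
  distributions on a countable set, so the bound is an equality. Lower bounds suffice throughout;
  in particular simultaneous events need not be excluded.
\<close>

section \<open>Right-constant paths and their jump times\<close>

text \<open>The obstacle is that household \<open>j\<close> is seen through a process shifted by a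
  random formation time, while the Markov property of the \<open>Z j\<close> is given at
  deterministic times only. Rounded formation times take countably many values, and on each of them
  a skeleton path is described by events about the family \<pi> and about the single
  \<open>Z j\<close> at multiples of \<open>h\<close>. Let \<open>s\<close> be the weight of staying
  in \<open>x\<close> and \<open>w\<close> that of moving to \<open>y\<close>. Then
  \<open>s = 1 - D h + o(h)\<close> and \<open>w = q h + o(h)\<close>, where \<open>D\<close> is the
  total rate and \<open>q\<close> the rate from \<open>x\<close> to \<open>y\<close>. Summing over
  the number of repetitions of \<open>x\<close> gives
  \<open>(s + s^2 + ...) w = s w / (1 - s)\<close>, which tends to \<open>q / D\<close>. This is
  where the normalisation of the in-degree chain comes from. Skeleton and census chain are compared
  at each sample point separately, as soon as the mesh is below a quarter of the smallest gap
  between the first jumps. That threshold is random, so for a fixed mesh there remains an error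
  event, whose probability tends to 0.\<close>

definition right_constant :: "(real \<Rightarrow> 's) \<Rightarrow> bool" where
  "right_constant f \<longleftrightarrow> (\<forall>t\<ge>0. \<exists>e>0. \<forall>s. t \<le> s \<and> s < t + e \<longrightarrow> f s = f t)"

lemma right_constantE:
  assumes "right_constant f" "t \<ge> 0"
  obtains e where "e > 0" "\<And>s. t \<le> s \<Longrightarrow> s < t + e \<Longrightarrow> f s = f t"
  using assms unfolding right_constant_def by blast

lemma right_constantI:
  assumes "\<And>t. t \<ge> 0 \<Longrightarrow> \<exists>e>0. \<forall>s. t \<le> s \<and> s < t + e \<longrightarrow> f s = f t"
  shows "right_constant f"
  using assms unfolding right_constant_def by blast

text \<open>In a discrete space right-continuity means constancy just after each time. The
  topology-free form lets one notion serve the sizes of single households and the list-valued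
  process built from them.\<close>

lemma right_constant_if_right_continuous:
  fixes f :: "real \<Rightarrow> 's :: discrete_topology"
  assumes "\<And>t. t \<ge> 0 \<Longrightarrow> continuous (at_right t) f"
  shows "right_constant f"
proof (rule right_constantI)
  fix t :: real assume "t \<ge> 0"
  then have "eventually (\<lambda>s. f s = f t) (at_right t)"
    using assms[of t] by (simp add: continuous_within tendsto_discrete)
  then obtain b where b: "b > t" "\<And>s. s > t \<Longrightarrow> s < b \<Longrightarrow> f s = f t"
    unfolding eventually_at_right_field by blast
  show "\<exists>e>0. \<forall>s. t \<le> s \<and> s < t + e \<longrightarrow> f s = f t"
  proof (intro exI[of _ "b - t"] conjI allI impI)
    fix s assume "t \<le> s \<and> s < t + (b - t)"
    then show "f s = f t" using b(2)[of s] by (cases "s = t") auto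
  qed (use b in auto)
qed

text \<open>Constancy just after \<open>c\<close> keeps the infimum away from \<open>c\<close>. The
  infimum is attained: if \<open>f i = f c\<close>, constancy just after \<open>i\<close> would make
  \<open>i + e'\<close> a lower bound of the set as well.\<close>

lemma first_change:
  fixes f :: "real \<Rightarrow> 's"
  assumes f: "right_constant f" and c: "c \<ge> 0" and ne: "{u. u > c \<and> f u \<noteq> f c} \<noteq> {}"
  defines "i \<equiv> Inf {u. u > c \<and> f u \<noteq> f c}"
  shows "c < i" "f i \<noteq> f c" "\<And>u. c \<le> u \<Longrightarrow> u < i \<Longrightarrow> f u = f c"
proof -
  let ?J = "{u. u > c \<and> f u \<noteq> f c}"
  have bdd: "bdd_below ?J" by (intro bdd_belowI[of _ c]) auto
  obtain e where e: "e > 0" "\<And>s. c \<le> s \<Longrightarrow> s < c + e \<Longrightarrow> f s = f c"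
    using right_constantE[OF f c] by blast
  have "c + e \<le> i" unfolding i_def
  proof (intro cInf_greatest[OF ne])
    fix u assume "u \<in> ?J"
    then show "c + e \<le> u" using e(2)[of u] by (cases "u < c + e") auto
  qed
  then show ci: "c < i" using e by simp
  show const: "f u = f c" if "c \<le> u" "u < i" for u
  proof (rule ccontr)
    assume "f u \<noteq> f c"
    then have "u \<in> ?J" using that by (cases "u = c") auto
    then show False using cInf_lower[OF _ bdd, of u] that unfolding i_def by simp
  qed
  show "f i \<noteq> f c"
  proof
    assume eq: "f i = f c"
    obtain e' where e': "e' > 0" "\<And>s. i \<le> s \<Longrightarrow> s < i + e' \<Longrightarrow> f s = f i"
      using right_constantE[OF f, of i] ci c by auto
    have "i + e' \<le> i" unfolding i_def
    proof (intro cInf_greatest[OF ne])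
      fix u assume u: "u \<in> ?J"
      then have "i \<le> u" using cInf_lower[OF u bdd] unfolding i_def by simp
      then show "Inf ?J + e' \<le> u" using e'(2)[of u] u eq unfolding i_def
        by (cases "u < Inf ?J + e'") auto
    qed
    then show False using e' by simp
  qed
qed

lemma jump_time_nonneg: "jump_time X t \<omega> \<ge> 0"
proof (induction t)
  case (Suc t)
  let ?c = "jump_time X t \<omega>"
  have "?c \<le> jump_time X (Suc t) \<omega>"
    by (auto simp: Let_def intro!: cInf_greatest)
  with Suc show ?case by linarith
qed simp

text \<open>The witness \<open>u\<close> excludes the default branch of \<open>jump_time\<close>, so
  the next jump time is the infimum treated in \<open>first_change\<close>.\<close>

lemma jump_time_Suc:
  assumes "right_constant (\<lambda>u. X u \<omega>)" and "u > jump_time X t \<omega>"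
    and "X u \<omega> \<noteq> X (jump_time X t \<omega>) \<omega>"
  shows "jump_time X t \<omega> < jump_time X (Suc t) \<omega>"
    and "jump_time X (Suc t) \<omega> \<le> u"
    and "X (jump_time X (Suc t) \<omega>) \<omega> \<noteq> X (jump_time X t \<omega>) \<omega>"
    and "\<And>v. jump_time X t \<omega> \<le> v \<Longrightarrow> v < jump_time X (Suc t) \<omega> \<Longrightarrow>
           X v \<omega> = X (jump_time X t \<omega>) \<omega>"
proof -
  let ?c = "jump_time X t \<omega>"
  let ?J = "{u. u > ?c \<and> X u \<omega> \<noteq> X ?c \<omega>}"
  have u: "u \<in> ?J" using assms by simp
  then have ne: "?J \<noteq> {}" by blast
  have eq: "jump_time X (Suc t) \<omega> = Inf ?J" using ne by (auto simp: Let_def)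
  note fc = first_change[OF assms(1) jump_time_nonneg ne]
  show "?c < jump_time X (Suc t) \<omega>" "X (jump_time X (Suc t) \<omega>) \<omega> \<noteq> X ?c \<omega>"
    "\<And>v. jump_time X t \<omega> \<le> v \<Longrightarrow> v < jump_time X (Suc t) \<omega> \<Longrightarrow>
           X v \<omega> = X (jump_time X t \<omega>) \<omega>"
    unfolding eq by (intro fc; assumption)+
  show "jump_time X (Suc t) \<omega> \<le> u" unfolding eq
    by (intro cInf_lower[OF u] bdd_belowI[of _ ?c]) auto
qed

text \<open>\<open>S\<close> is approximated from the right by random times with countably many
  values, for which the composition is measurable. By right-constancy the approximation is
  eventually exact at each sample point.\<close>

lemma measurable_at_random_time:
  fixes X :: "real \<Rightarrow> 'a \<Rightarrow> 's :: countable"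
  assumes X: "\<And>u. u \<ge> 0 \<Longrightarrow> X u \<in> M \<rightarrow>\<^sub>M count_space UNIV"
    and rc: "\<And>\<omega>. \<omega> \<in> space M \<Longrightarrow> right_constant (\<lambda>u. X u \<omega>)"
    and S[measurable]: "S \<in> borel_measurable M" and S0: "\<And>\<omega>. \<omega> \<in> space M \<Longrightarrow> S \<omega> \<ge> 0"
  shows "(\<lambda>\<omega>. X (S \<omega>) \<omega>) \<in> M \<rightarrow>\<^sub>M count_space UNIV"
proof -
  \<comment> \<open>Floor plus one gives a grid time strictly after \<open>S \<omega>\<close> and at
    most \<open>1 / Suc n\<close> later, on the side where the path is constant.\<close>
  define g where "g n \<omega> = nat \<lfloor>S \<omega> * real (Suc n)\<rfloor> + 1" for n \<omega>
  have g[measurable]: "g n \<in> M \<rightarrow>\<^sub>M count_space UNIV" for n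
    unfolding g_def by measurable
  have Xn: "(\<lambda>\<omega>. X (real (g n \<omega>) / real (Suc n)) \<omega>) \<in> M \<rightarrow>\<^sub>M count_space UNIV" for n
    by (rule measurable_compose_countable[where f = "\<lambda>i. X (real i / real (Suc n))"])
       (auto intro: X)
  have lim: "eventually (\<lambda>n. X (real (g n \<omega>) / real (Suc n)) \<omega> = X (S \<omega>) \<omega>) sequentially"
    if \<omega>: "\<omega> \<in> space M" for \<omega>
  proof -
    obtain e where e: "e > 0" "\<And>s. S \<omega> \<le> s \<Longrightarrow> s < S \<omega> + e \<Longrightarrow> X s \<omega> = X (S \<omega>) \<omega>"
      using right_constantE[OF rc[OF \<omega>] S0[OF \<omega>]] by blast
    obtain m where m: "inverse (real (Suc m)) < e" using reals_Archimedean[OF e(1)] by blast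
    have "X (real (g n \<omega>) / real (Suc n)) \<omega> = X (S \<omega>) \<omega>" if "n \<ge> m" for n
    proof (rule e(2))
      have *: "real (g n \<omega>) = of_int \<lfloor>S \<omega> * real (Suc n)\<rfloor> + 1"
        using S0[OF \<omega>] unfolding g_def by simp
      show "S \<omega> \<le> real (g n \<omega>) / real (Suc n)"
        unfolding * by (simp add: pos_le_divide_eq)
      have "real (g n \<omega>) / real (Suc n) \<le> (S \<omega> * real (Suc n) + 1) / real (Suc n)"
        unfolding * by (intro divide_right_mono add_right_mono of_int_floor_le) simp
      also have "\<dots> = S \<omega> + inverse (real (Suc n))" by (simp add: field_simps)
      also have "inverse (real (Suc n)) \<le> inverse (real (Suc m))"
        using that by (intro le_imp_inverse_le) auto
      finally show "real (g n \<omega>) / real (Suc n) < S \<omega> + e" using m by simp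
    qed
    then show ?thesis unfolding eventually_sequentially by blast
  qed
  show ?thesis
    unfolding measurable_count_space_eq2_countable
  proof (intro conjI ballI)
    fix y
    have "(\<lambda>\<omega>. X (S \<omega>) \<omega>) -` {y} \<inter> space M =
      {\<omega>\<in>space M. \<exists>m. \<forall>n\<ge>m. X (real (g n \<omega>) / real (Suc n)) \<omega> = y}"
    proof (intro set_eqI iffI)
      fix \<omega> assume "\<omega> \<in> (\<lambda>\<omega>. X (S \<omega>) \<omega>) -` {y} \<inter> space M"
      then show "\<omega> \<in> {\<omega>\<in>space M. \<exists>m. \<forall>n\<ge>m. X (real (g n \<omega>) / real (Suc n)) \<omega> = y}"
        using lim[of \<omega>] by (auto simp: eventually_sequentially)
    next
      fix \<omega> assume "\<omega> \<in> {\<omega>\<in>space M. \<exists>m. \<forall>n\<ge>m. X (real (g n \<omega>) / real (Suc n)) \<omega> = y}"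
      then have \<omega>: "\<omega> \<in> space M"
        and ev: "eventually (\<lambda>n. X (real (g n \<omega>) / real (Suc n)) \<omega> = y) sequentially"
        by (auto simp: eventually_sequentially)
      have "eventually (\<lambda>n::nat. X (S \<omega>) \<omega> = y) sequentially"
        using ev lim[OF \<omega>] by eventually_elim simp
      then show "\<omega> \<in> (\<lambda>\<omega>. X (S \<omega>) \<omega>) -` {y} \<inter> space M" using \<omega> by simp
    qed
    also have "\<dots> \<in> sets M" using Xn by measurable
    finally show "(\<lambda>\<omega>. X (S \<omega>) \<omega>) -` {y} \<inter> space M \<in> sets M" .
  qed auto
qed

lemma measurable_jump_time:
  fixes X :: "real \<Rightarrow> 'a \<Rightarrow> 's :: countable"
  assumes X: "\<And>u. u \<ge> 0 \<Longrightarrow> X u \<in> M \<rightarrow>\<^sub>M count_space UNIV"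
    and rc: "\<And>\<omega>. \<omega> \<in> space M \<Longrightarrow> right_constant (\<lambda>u. X u \<omega>)"
  shows "jump_time X t \<in> borel_measurable M"
proof (induction t)
  case 0
  have "jump_time X 0 = (\<lambda>_. 0)" by (simp add: fun_eq_iff)
  then show ?case by simp
next
  case (Suc t)
  note [measurable] = Suc
  let ?c = "jump_time X t"
  \<comment> \<open>The rational test times are clipped at 0, because \<open>X\<close> is assumed
    measurable at nonnegative times only.\<close>
  let ?r = "\<lambda>q::rat. max 0 (real_of_rat q)"
  let ?Q = "range ?r"
  have [measurable]: "(\<lambda>\<omega>. X (?c \<omega>) \<omega>) \<in> M \<rightarrow>\<^sub>M count_space UNIV"
    by (rule measurable_at_random_time[OF X rc]) (auto intro: jump_time_nonneg)
  \<comment> \<open>A change at \<open>u\<close> persists just after \<open>u\<close>, hence is seen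
    at test times arbitrarily close to \<open>u\<close>. The first disjunct is the default branch,
    where no change occurs and the jump time stays at \<open>?c \<omega>\<close>.\<close>
  have eq: "jump_time X (Suc t) \<omega> < s \<longleftrightarrow>
      ((\<forall>q\<in>?Q. ?c \<omega> < q \<longrightarrow> X q \<omega> = X (?c \<omega>) \<omega>) \<and> ?c \<omega> < s) \<or>
      (\<exists>q\<in>?Q. ?c \<omega> < q \<and> q < s \<and> X q \<omega> \<noteq> X (?c \<omega>) \<omega>)" if \<omega>: "\<omega> \<in> space M" for \<omega> s
  proof -
    let ?J = "{u. u > ?c \<omega> \<and> X u \<omega> \<noteq> X (?c \<omega>) \<omega>}"
    have dense: "\<exists>q\<in>?Q. ?c \<omega> < q \<and> q < r \<and> X q \<omega> \<noteq> X (?c \<omega>) \<omega>"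
      if u: "u \<in> ?J" "u < r" for u r
    proof -
      have "u \<ge> 0" using u jump_time_nonneg[of X t \<omega>] by auto
      then obtain e where e: "e > 0" "\<And>s. u \<le> s \<Longrightarrow> s < u + e \<Longrightarrow> X s \<omega> = X u \<omega>"
        using right_constantE[OF rc[OF \<omega>]] by blast
      obtain q where q: "q \<in> \<rat>" "u < q" "q < min r (u + e)"
        using Rats_dense_in_real[of u "min r (u + e)"] u(2) e(1) by auto
      then obtain q' where "q = real_of_rat q'" by (auto elim: Rats_cases)
      then have "q = ?r q'" using q \<open>u \<ge> 0\<close> by simp
      then have "q \<in> ?Q" by (rule range_eqI)
      moreover have "?c \<omega> < q" "q < r" "X q \<omega> \<noteq> X (?c \<omega>) \<omega>" using e(2)[of q] u q by simp_all
      ultimately show ?thesis by blast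
    qed
    have bdd: "bdd_below ?J" by (intro bdd_belowI[of _ "?c \<omega>"]) auto
    show ?thesis
    proof (cases "?J = {}")
      case True
      then have "jump_time X (Suc t) \<omega> = ?c \<omega>" by (simp add: Let_def)
      moreover have "\<forall>q\<in>?Q. ?c \<omega> < q \<longrightarrow> X q \<omega> = X (?c \<omega>) \<omega>" using True by blast
      ultimately show ?thesis by auto
    next
      case False
      then have 1: "jump_time X (Suc t) \<omega> = Inf ?J" by (auto simp: Let_def)
      obtain u where u: "u \<in> ?J" using False by blast
      have 2: "\<not> (\<forall>q\<in>?Q. ?c \<omega> < q \<longrightarrow> X q \<omega> = X (?c \<omega>) \<omega>)"
        using dense[OF u, of "u + 1"] by fastforce
      have "Inf ?J < s \<longleftrightarrow> (\<exists>u\<in>?J. u < s)" by (rule cInf_less_iff[OF False bdd])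
      also have "\<dots> \<longleftrightarrow> (\<exists>q\<in>?Q. ?c \<omega> < q \<and> q < s \<and> X q \<omega> \<noteq> X (?c \<omega>) \<omega>)"
        using dense by blast
      finally show ?thesis unfolding 1 using 2 by blast
    qed
  qed
  have X'[measurable]: "X (?r q) \<in> M \<rightarrow>\<^sub>M count_space UNIV" for q
    by (rule X) simp
  show ?case
  proof (rule borel_measurableI_less)
    fix s
    have "{\<omega>\<in>space M. jump_time X (Suc t) \<omega> < s} = {\<omega>\<in>space M.
      ((\<forall>q. ?c \<omega> < ?r q \<longrightarrow> X (?r q) \<omega> = X (?c \<omega>) \<omega>) \<and> ?c \<omega> < s) \<or>
      (\<exists>q. ?c \<omega> < ?r q \<and> ?r q < s \<and> X (?r q) \<omega> \<noteq> X (?c \<omega>) \<omega>)}"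
      using eq by blast
    also have "\<dots> \<in> sets M" by measurable
    finally show "{\<omega>\<in>space M. jump_time X (Suc t) \<omega> < s} \<in> sets M" .
  qed
qed

section \<open>The skeleton of the household process\<close>

lemma formation_time_0 [simp]: "formation_time \<pi> 0 \<omega> = 0"
  by (simp add: formation_time_def)

lemma formation_time_Suc: "formation_time \<pi> (Suc k) \<omega> = formation_time \<pi> k \<omega> + \<pi> (Suc k) \<omega>"
  by (simp add: formation_time_def)

text \<open>The first \<open>m\<close> with \<open>u\<close> below formation time
  \<open>Suc m\<close> satisfies the lower bound by minimality, or because formation time 0 is 0. If
  there is no such \<open>m\<close>, both predicates are empty and \<open>LEAST\<close> returns the
  same unspecified value. Hence the equation holds at every sample point, without monotone formation
  times.\<close>

lemma households_eq_first_passage: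
  assumes "u \<ge> 0"
  shows "households \<pi> u \<omega> = Suc (LEAST m. u < formation_time \<pi> (Suc m) \<omega>)"
proof -
  let ?T = "\<lambda>m. formation_time \<pi> m \<omega>"
  have "(LEAST m. ?T m \<le> u \<and> u < ?T (Suc m)) = (LEAST m. u < ?T (Suc m))"
  proof (cases "\<exists>m. u < ?T (Suc m)")
    case True
    define l where "l = (LEAST m. u < ?T (Suc m))"
    have l: "u < ?T (Suc l)" unfolding l_def using True by (rule LeastI_ex)
    have "?T l \<le> u"
    proof (cases l)
      case (Suc l')
      then show ?thesis using not_less_Least[of l' "\<lambda>m. u < ?T (Suc m)"] l_def by simp
    qed (simp add: assms)
    with l show ?thesis unfolding l_def[symmetric]
      by (intro Least_equality) (auto simp: l_def intro: Least_le)
  next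
    case False
    then have "(\<lambda>m. ?T m \<le> u \<and> u < ?T (Suc m)) = (\<lambda>m. u < ?T (Suc m))" by auto
    then show ?thesis by simp
  qed
  then show ?thesis unfolding households_def by simp
qed

lemma formation_time_le:
  assumes "u \<ge> 0" "j < households \<pi> u \<omega>"
  shows "formation_time \<pi> j \<omega> \<le> u"
proof (cases j)
  case (Suc j')
  then have "j' < (LEAST m. u < formation_time \<pi> (Suc m) \<omega>)"
    using assms by (simp add: households_eq_first_passage)
  then show ?thesis using Suc not_less_Least[of j' "\<lambda>m. u < formation_time \<pi> (Suc m) \<omega>"] by simp
qed (simp add: assms)

lemma right_constant_households: "right_constant (\<lambda>u. households \<pi> u \<omega>)"
proof (rule right_constantI)
  fix t :: real assume t: "t \<ge> 0"
  let ?T = "\<lambda>m. formation_time \<pi> m \<omega>"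
  show "\<exists>e>0. \<forall>s. t \<le> s \<and> s < t + e \<longrightarrow> households \<pi> s \<omega> = households \<pi> t \<omega>"
  proof (cases "\<exists>m. t < ?T (Suc m)")
    case True
    define l where "l = (LEAST m. t < ?T (Suc m))"
    have l: "t < ?T (Suc l)" unfolding l_def using True by (rule LeastI_ex)
    have "(LEAST m. s < ?T (Suc m)) = l" if s: "t \<le> s" "s < ?T (Suc l)" for s
    proof (rule Least_equality)
      fix m assume "s < ?T (Suc m)"
      then have "t < ?T (Suc m)" using s by simp
      then show "l \<le> m" unfolding l_def by (rule Least_le)
    qed (use s in simp)
    then show ?thesis using t l
      by (intro exI[of _ "?T (Suc l) - t"]) (auto simp: households_eq_first_passage)
  next
    \<comment> \<open>If no formation time exceeds \<open>t\<close>, then \<open>LEAST\<close> sees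
      the same empty predicate at all later times, so its unspecified value does not vary.\<close>
    case False
    then have "households \<pi> s \<omega> = households \<pi> t \<omega>" if "t \<le> s" for s
    proof -
      have "(\<lambda>m. s < ?T (Suc m)) = (\<lambda>m. t < ?T (Suc m))" using False that by (intro ext) (meson not_le order_trans)
      then have "(LEAST m. s < ?T (Suc m)) = (LEAST m. t < ?T (Suc m))" by (rule arg_cong)
      with that t show ?thesis by (simp add: households_eq_first_passage)
    qed
    then show ?thesis using zero_less_one by blast
  qed
qed

lemma households_pos: "households \<pi> u \<omega> \<ge> 1"
  by (simp add: households_def)

lemma length_yule_process [simp]: "length (yule_process Z \<pi> u \<omega>) = households \<pi> u \<omega>"
  by (simp add: yule_process_def)

lemma nth_yule_process:
  "j < households \<pi> u \<omega> \<Longrightarrow>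
    yule_process Z \<pi> u \<omega> ! j = Z (Suc j) (u - formation_time \<pi> j \<omega>) \<omega>"
  by (simp add: yule_process_def del: upt_Suc)

lemma right_constant_yule_process:
  assumes "\<And>j. j \<ge> 1 \<Longrightarrow> right_constant (\<lambda>u. Z j u \<omega>)"
  shows "right_constant (\<lambda>u. yule_process Z \<pi> u \<omega>)"
proof (rule right_constantI)
  fix t :: real assume t: "t \<ge> 0"
  let ?T = "\<lambda>m. formation_time \<pi> m \<omega>" and ?n = "households \<pi> t \<omega>"
  \<comment> \<open>Induction on the number of coordinates controlled at once; each new one shrinks
    \<open>e\<close> to a minimum. By \<open>formation_time_le\<close> every existing household has
    a nonnegative age, where right-constancy applies.\<close>
  have "\<exists>e>0. \<forall>s. t \<le> s \<and> s < t + e \<longrightarrow>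
      (households \<pi> s \<omega> = ?n) \<and> (\<forall>j<m. Z (Suc j) (s - ?T j) \<omega> = Z (Suc j) (t - ?T j) \<omega>)"
    if "m \<le> ?n" for m using that
  proof (induction m)
    case 0
    then show ?case using right_constant_households[of \<pi> \<omega>] t unfolding right_constant_def by auto
  next
    case (Suc m)
    then obtain e where e: "e > 0" "\<And>s. t \<le> s \<Longrightarrow> s < t + e \<Longrightarrow>
      (households \<pi> s \<omega> = ?n) \<and> (\<forall>j<m. Z (Suc j) (s - ?T j) \<omega> = Z (Suc j) (t - ?T j) \<omega>)"
      by auto
    have "t - ?T m \<ge> 0" using formation_time_le[OF t, of m \<pi> \<omega>] Suc.prems by simp
    then obtain e' where e': "e' > 0" "\<And>s. t - ?T m \<le> s \<Longrightarrow> s < t - ?T m + e' \<Longrightarrow>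
        Z (Suc m) s \<omega> = Z (Suc m) (t - ?T m) \<omega>"
      using right_constantE[OF assms[of "Suc m"]] by (metis le_add1 plus_1_eq_Suc)
    show ?case
    proof (intro exI[of _ "min e e'"] conjI allI impI)
      fix s j assume s: "t \<le> s \<and> s < t + min e e'" and j: "j < Suc m"
      show "Z (Suc j) (s - ?T j) \<omega> = Z (Suc j) (t - ?T j) \<omega>"
      proof (cases "j = m")
        case True
        then show ?thesis using e'(2)[of "s - ?T m"] s min.cobounded2[of e e'] by auto
      next
        case False
        then show ?thesis using e(2)[of s] s j min.cobounded1[of e e'] by auto
      qed
    next
      fix s assume "t \<le> s \<and> s < t + min e e'"
      then show "households \<pi> s \<omega> = ?n"
        using e(2)[of s] min.cobounded1[of e e'] by auto
    qed (use e e' in simp)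
  qed
  from this[OF order_refl] obtain e where e: "e > 0" "\<And>s. t \<le> s \<Longrightarrow> s < t + e \<Longrightarrow>
      (households \<pi> s \<omega> = ?n) \<and> (\<forall>j<?n. Z (Suc j) (s - ?T j) \<omega> = Z (Suc j) (t - ?T j) \<omega>)"
    by blast
  show "\<exists>e>0. \<forall>s. t \<le> s \<and> s < t + e \<longrightarrow> yule_process Z \<pi> s \<omega> = yule_process Z \<pi> t \<omega>"
  proof (intro exI[of _ e] conjI allI impI)
    fix s assume "t \<le> s \<and> s < t + e"
    then show "yule_process Z \<pi> s \<omega> = yule_process Z \<pi> t \<omega>"
      using e(2)[of s] by (intro nth_equalityI) (auto simp: nth_yule_process)
  qed (rule e(1))
qed

text \<open>
  Rounding the formation times up to the grid has the effect that the skeleton only involves the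
  values of the \<open>Z j\<close> at grid times, so that it factorises by independence without conditioning on
  the formation times.
\<close>

definition skeleton ::
    "(nat \<Rightarrow> real \<Rightarrow> 'a \<Rightarrow> nat) \<Rightarrow> (nat \<Rightarrow> 'a \<Rightarrow> real) \<Rightarrow> real \<Rightarrow> nat \<Rightarrow> 'a \<Rightarrow> nat list" where
  "skeleton Z \<pi> h k \<omega> =
     map (\<lambda>j. Z (Suc j) (real (k - nat \<lceil>formation_time \<pi> j \<omega> / h\<rceil>) * h) \<omega>)
       [0..<households \<pi> (real k * h) \<omega>]"

lemma length_skeleton [simp]: "length (skeleton Z \<pi> h k \<omega>) = households \<pi> (real k * h) \<omega>"
  by (simp add: skeleton_def)

lemma nth_skeleton:
  "j < households \<pi> (real k * h) \<omega> \<Longrightarrow> skeleton Z \<pi> h k \<omega> ! j =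
    Z (Suc j) (real (k - nat \<lceil>formation_time \<pi> j \<omega> / h\<rceil>) * h) \<omega>"
  by (simp add: skeleton_def)

text \<open>The witness \<open>n\<close> is the holding time of the head. The final state is asked
  for its two grid points only, since the list says nothing about what happens afterwards.\<close>

fun follows :: "(nat \<Rightarrow> 's) \<Rightarrow> 's list \<Rightarrow> nat \<Rightarrow> bool" where
  "follows X [] k \<longleftrightarrow> True"
| "follows X [x] k \<longleftrightarrow> X k = x \<and> X (Suc k) = x"
| "follows X (x # y # xs) k \<longleftrightarrow> (\<exists>n\<ge>2. (\<forall>m<n. X (k + m) = x) \<and> follows X (y # xs) (k + n))"

lemma follows_hd: "follows X (x # xs) k \<Longrightarrow> X k = x \<and> X (Suc k) = x"
proof (cases xs)
  case (Cons y ys)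
  assume "follows X (x # xs) k"
  then obtain n where "n \<ge> 2" "\<And>m. m < n \<Longrightarrow> X (k + m) = x" using Cons by auto
  from this(1) this(2)[of 0] this(2)[of 1] show ?thesis by simp
qed simp

text \<open>
  Because each state has to be held for two steps, a mixed state seen at the only grid point within
  distance \<open>h\<close> after a jump cannot be part of \<open>xs\<close>.
\<close>

lemma follows_eq_jump_chain:
  fixes Y :: "real \<Rightarrow> 's" and \<tau> :: "nat \<Rightarrow> real"
  assumes h: "h > 0" and \<tau>: "\<And>i. \<tau> i \<ge> 0"
    and X: "\<And>i k. \<tau> i + h \<le> real k * h \<Longrightarrow> real k * h < \<tau> (Suc i) \<Longrightarrow> X k = Y (\<tau> i)"
    and gap: "\<And>i. i \<le> t \<Longrightarrow> \<tau> i + 4 * h < \<tau> (Suc i)"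
    and Y: "\<And>i. Y (\<tau> (Suc i)) \<noteq> Y (\<tau> i)"
    and dist: "successively (\<noteq>) xs"
    and fol: "follows X xs k" and k: "k \<in> {nat \<lceil>\<tau> i / h\<rceil>, Suc (nat \<lceil>\<tau> i / h\<rceil>)}"
    and len: "i + length xs \<le> Suc t" and m: "m < length xs"
  shows "xs ! m = Y (\<tau> (i + m))"
  using dist fol k len m
proof (induction xs arbitrary: i k m)
  case (Cons x xs)
  \<comment> \<open>\<open>K i\<close> is the first grid index not before \<open>\<tau> i\<close>.
    It is the only one within distance \<open>h\<close> after \<open>\<tau> i\<close>, hence the
    only one where \<open>X\<close> may show a mixed state.\<close>
  define K where "K i = nat \<lceil>\<tau> i / h\<rceil>" for i
  have K: "\<tau> i \<le> real (K i) * h" "real (K i) * h < \<tau> i + h" for i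
  proof -
    have *: "real (K i) = of_int \<lceil>\<tau> i / h\<rceil>" unfolding K_def using \<tau>[of i] h by simp
    have "\<tau> i / h \<le> real (K i)" "real (K i) < \<tau> i / h + 1" unfolding * by linarith+
    then show "\<tau> i \<le> real (K i) * h" "real (K i) * h < \<tau> i + h"
      using h by (simp_all add: field_simps)
  qed
  have i: "i \<le> t" using Cons.prems by simp
  \<comment> \<open>The 4 in \<open>gap\<close> is 1 + 3: \<open>K i\<close> lies less than one mesh
    after \<open>\<tau> i\<close>, and three further grid points still have to precede
    \<open>\<tau> (Suc i)\<close>.\<close>
  have XY: "X k' = Y (\<tau> i)" if "i \<le> t" "K i < k'" "k' < K (Suc i) \<or> k' \<le> K i + 3" for i k'
  proof (rule X)
    have "real (K i) + 1 \<le> real k'" using that(2) by simp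
    then have "(real (K i) + 1) * h \<le> real k' * h" using h by (intro mult_right_mono) auto
    then show "\<tau> i + h \<le> real k' * h" using K(1)[of i] by (simp add: algebra_simps)
    show "real k' * h < \<tau> (Suc i)"
    proof (cases "k' < K (Suc i)")
      case True
      then have "real k' + 1 \<le> real (K (Suc i))" by simp
      then have "(real k' + 1) * h \<le> real (K (Suc i)) * h" using h by (intro mult_right_mono) auto
      then show ?thesis using K(2)[of "Suc i"] by (simp add: algebra_simps)
    next
      case False
      then have "real k' \<le> real (K i) + 3" using that(3) by simp
      then have "real k' * h \<le> (real (K i) + 3) * h" using h by (intro mult_right_mono) auto
      then show ?thesis using K(2)[of i] gap[OF that(1)] by (simp add: algebra_simps)
    qed
  qed
  have kK: "k = K i \<or> k = Suc (K i)" using Cons.prems(3) by (simp add: K_def)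
  have "X (Suc (K i)) = x" using kK follows_hd[OF Cons.prems(2)] by auto
  then have x: "x = Y (\<tau> i)" using XY[OF i, of "Suc (K i)"] by simp
  show ?case
  proof (cases m)
    case 0
    then show ?thesis using x by simp
  next
    case (Suc m')
    then obtain y ys where xs: "xs = y # ys" using Cons.prems by (cases xs) auto
    obtain n where n: "n \<ge> 2" "\<And>m. m < n \<Longrightarrow> X (k + m) = x" "follows X xs (k + n)"
      using Cons.prems(2) xs by auto
    have xy: "x \<noteq> y" using Cons.prems(1) xs by simp
    have y: "X (k + n) = y" using follows_hd n(3) xs by fastforce
    have k: "K i \<le> k" "k \<le> Suc (K i)" using kK by auto
    have KS: "K i + 3 < K (Suc i)"
    proof (rule ccontr)
      assume "\<not> K i + 3 < K (Suc i)"
      then have "real (K (Suc i)) * h \<le> (real (K i) + 3) * h"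
        using h by (intro mult_right_mono) auto
      then show False using K(2)[of i] K(1)[of "Suc i"] gap[OF i] by (simp add: algebra_simps)
    qed
    have i': "Suc i \<le> t" using Cons.prems xs by simp
    \<comment> \<open>Before \<open>K (Suc i)\<close> the path still shows \<open>x\<close>, so
      \<open>y\<close> cannot appear there. If \<open>y\<close> appeared only after
      \<open>Suc (K (Suc i))\<close>, the path would show \<open>x\<close> at that index, where it
      already shows the next state. This restores the assumption on \<open>k\<close> for the
      tail.\<close>
    have "K (Suc i) \<le> k + n"
    proof (rule ccontr)
      assume "\<not> K (Suc i) \<le> k + n"
      then have "X (k + n) = Y (\<tau> i)" using XY[OF i, of "k + n"] k n(1) by simp
      then show False using y xy x by simp
    qed
    moreover have "k + n \<le> Suc (K (Suc i))"
    proof (rule ccontr)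
      assume "\<not> k + n \<le> Suc (K (Suc i))"
      then have "X (k + (Suc (K (Suc i)) - k)) = x" using KS k by (intro n(2)) auto
      then have "X (Suc (K (Suc i))) = x" using KS k by simp
      then show False using XY[OF i', of "Suc (K (Suc i))"] x Y[of i] by simp
    qed
    ultimately have "k + n \<in> {nat \<lceil>\<tau> (Suc i) / h\<rceil>, Suc (nat \<lceil>\<tau> (Suc i) / h\<rceil>)}"
      unfolding K_def[symmetric] by auto
    moreover have "successively (\<noteq>) xs" using Cons.prems(1) xs by simp
    ultimately show ?thesis
      using Cons.IH[of "k + n" "Suc i" m'] n(3) Cons.prems Suc by simp
  qed
qed simp

section \<open>Pathwise comparison of the skeleton with the census chain\<close>

context
  fixes \<pi> :: "nat \<Rightarrow> 'a \<Rightarrow> real" and \<omega> :: 'a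
  assumes \<pi>_pos: "\<And>k. k \<ge> 1 \<Longrightarrow> \<pi> k \<omega> > 0"
begin

lemma strict_mono_formation_time: "strict_mono (\<lambda>k. formation_time \<pi> k \<omega>)"
  using \<pi>_pos by (intro strict_mono_Suc_iff[THEN iffD2]) (auto simp: formation_time_Suc)

lemma households_eqI:
  assumes "formation_time \<pi> m \<omega> \<le> u" "u < formation_time \<pi> (Suc m) \<omega>"
  shows "households \<pi> u \<omega> = Suc m"
proof -
  have "(LEAST m. formation_time \<pi> m \<omega> \<le> u \<and> u < formation_time \<pi> (Suc m) \<omega>) = m"
  proof (rule Least_equality)
    fix l assume "formation_time \<pi> l \<omega> \<le> u \<and> u < formation_time \<pi> (Suc l) \<omega>"
    then have "formation_time \<pi> m \<omega> < formation_time \<pi> (Suc l) \<omega>" using assms by simp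
    then show "m \<le> l" using strict_mono_less[OF strict_mono_formation_time] by simp
  qed (use assms in simp)
  then show ?thesis by (simp add: households_def)
qed

context
  fixes Z :: "nat \<Rightarrow> real \<Rightarrow> 'a \<Rightarrow> nat"
  assumes rc: "\<And>j. j \<ge> 1 \<Longrightarrow> right_constant (\<lambda>u. Z j u \<omega>)"
begin

text \<open>The length of the process grows at the first formation time after a census time, so
  another jump occurs by then. Inductively every census time lies below some formation time, and the
  default branch of \<open>jump_time\<close> never occurs.\<close>

lemma jump_time_strict:
  "jump_time (yule_process Z \<pi>) t \<omega> < jump_time (yule_process Z \<pi>) (Suc t) \<omega>"
  and jump_time_change: "yule_process Z \<pi> (jump_time (yule_process Z \<pi>) (Suc t) \<omega>) \<omega> \<noteq>
    yule_process Z \<pi> (jump_time (yule_process Z \<pi>) t \<omega>) \<omega>"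
  and jump_time_const: "\<And>v. jump_time (yule_process Z \<pi>) t \<omega> \<le> v \<Longrightarrow>
    v < jump_time (yule_process Z \<pi>) (Suc t) \<omega> \<Longrightarrow>
    yule_process Z \<pi> v \<omega> = yule_process Z \<pi> (jump_time (yule_process Z \<pi>) t \<omega>) \<omega>"
proof -
  let ?\<tau> = "\<lambda>t. jump_time (yule_process Z \<pi>) t \<omega>" and ?T = "\<lambda>k. formation_time \<pi> k \<omega>"
  have rcY: "right_constant (\<lambda>u. yule_process Z \<pi> u \<omega>)"
    by (rule right_constant_yule_process[where Z = Z]) (rule rc)
  have step: "\<exists>k. ?\<tau> t < ?T k \<and> yule_process Z \<pi> (?T k) \<omega> \<noteq> yule_process Z \<pi> (?\<tau> t) \<omega>"
    if "?\<tau> t < ?T k" for t k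
  proof -
    \<comment> \<open>Minimality puts \<open>?\<tau> t\<close> between the formation times
      \<open>l - 1\<close> and \<open>l\<close>, so there are \<open>l\<close> households at
      \<open>?\<tau> t\<close> and \<open>Suc l\<close> at formation time \<open>l\<close>.\<close>
    define l where "l = (LEAST k. ?\<tau> t < ?T k)"
    have l: "?\<tau> t < ?T l" unfolding l_def using that by (rule LeastI)
    then have "l \<noteq> 0" using jump_time_nonneg[of "yule_process Z \<pi>" t \<omega>] by (intro notI) auto
    then obtain l' where l': "l = Suc l'" by (cases l) auto
    then have "?T l' \<le> ?\<tau> t" using not_less_Least[of l' "\<lambda>k. ?\<tau> t < ?T k"] l_def by simp
    then have "households \<pi> (?\<tau> t) \<omega> = l" using l l' by (simp add: households_eqI)
    moreover have "households \<pi> (?T l) \<omega> = Suc l"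
      by (intro households_eqI order_refl strict_monoD[OF strict_mono_formation_time]) simp
    ultimately have "length (yule_process Z \<pi> (?T l) \<omega>) \<noteq> length (yule_process Z \<pi> (?\<tau> t) \<omega>)"
      by simp
    then show ?thesis using l by metis
  qed
  have "\<exists>k. ?\<tau> t < ?T k" for t
  proof (induction t)
    case 0
    then show ?case using \<pi>_pos[of 1] by (intro exI[of _ 1]) (simp add: formation_time_def)
  next
    case (Suc t)
    then obtain k where k: "?\<tau> t < ?T k" "yule_process Z \<pi> (?T k) \<omega> \<noteq> yule_process Z \<pi> (?\<tau> t) \<omega>"
      using step by blast
    have "?\<tau> (Suc t) \<le> ?T k"
      by (rule jump_time_Suc(2)[OF rcY k])
    also have "\<dots> < ?T (Suc k)" by (rule strict_monoD[OF strict_mono_formation_time]) simp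
    finally show ?case by blast
  qed
  then obtain k where k: "?\<tau> t < ?T k"
      "yule_process Z \<pi> (?T k) \<omega> \<noteq> yule_process Z \<pi> (?\<tau> t) \<omega>"
    using step by blast
  note js = jump_time_Suc[OF rcY k]
  show "?\<tau> t < ?\<tau> (Suc t)" by (rule js(1))
  show "yule_process Z \<pi> (?\<tau> (Suc t)) \<omega> \<noteq> yule_process Z \<pi> (?\<tau> t) \<omega>" by (rule js(3))
  show "yule_process Z \<pi> v \<omega> = yule_process Z \<pi> (?\<tau> t) \<omega>"
    if "?\<tau> t \<le> v" "v < ?\<tau> (Suc t)" for v
    by (rule js(4)[OF that])
qed

text \<open>Rounding replaces the age of a household at time \<open>real k * h\<close> by an age
  that it truly had during the last mesh interval. That interval contains no jump, so the size is
  the same.\<close>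

lemma skeleton_eq_yule_process:
  assumes h: "h > 0" and k: "jump_time (yule_process Z \<pi>) i \<omega> + h \<le> real k * h"
    "real k * h < jump_time (yule_process Z \<pi>) (Suc i) \<omega>"
  shows "skeleton Z \<pi> h k \<omega> = yule_process Z \<pi> (jump_time (yule_process Z \<pi>) i \<omega>) \<omega>"
proof -
  let ?\<tau> = "\<lambda>t. jump_time (yule_process Z \<pi>) t \<omega>" and ?T = "\<lambda>k. formation_time \<pi> k \<omega>"
  have const: "yule_process Z \<pi> u \<omega> = yule_process Z \<pi> (?\<tau> i) \<omega>"
    if "real k * h - h < u" "u \<le> real k * h" for u
    using that k by (intro jump_time_const) auto
  have len: "households \<pi> u \<omega> = households \<pi> (?\<tau> i) \<omega>"
    if "real k * h - h < u" "u \<le> real k * h" for u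
    using arg_cong[OF const[OF that], of length] by simp
  have n: "households \<pi> (real k * h) \<omega> = households \<pi> (?\<tau> i) \<omega>" using h by (intro len) auto
  show ?thesis
  proof (rule nth_equalityI)
    fix j assume "j < length (skeleton Z \<pi> h k \<omega>)"
    then have j: "j < households \<pi> (?\<tau> i) \<omega>" by (simp add: n)
    define c where "c = nat \<lceil>?T j / h\<rceil>"
    have "?T j \<ge> ?T 0" by (rule monoD[OF strict_mono_mono[OF strict_mono_formation_time]]) simp
    then have T0: "?T j / h \<ge> 0" using h by simp
    have "real c = of_int \<lceil>?T j / h\<rceil>" unfolding c_def using T0 by simp
    then have "?T j / h \<le> real c" "real c < ?T j / h + 1" by linarith+
    then have c: "?T j \<le> real c * h" "real c * h < ?T j + h" using h by (simp_all add: field_simps)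
    have "?T j \<le> ?\<tau> i" by (rule formation_time_le[OF jump_time_nonneg j])
    then have "real c * h < real (Suc k) * h" using c k by (simp add: algebra_simps)
    then have "c \<le> k" using h by simp
    then have kc: "real (k - c) * h = real k * h - real c * h" by (simp add: of_nat_diff algebra_simps)
    \<comment> \<open>\<open>u\<close> is the true time at which household \<open>j\<close> has the
      age used by the skeleton.\<close>
    define u where "u = ?T j + real (k - c) * h"
    have u: "real k * h - h < u" "u \<le> real k * h" unfolding u_def kc using c by auto
    have "skeleton Z \<pi> h k \<omega> ! j = Z (Suc j) (u - ?T j) \<omega>"
      using j by (simp add: nth_skeleton n u_def c_def)
    also have "\<dots> = yule_process Z \<pi> u \<omega> ! j" using j len[OF u] by (simp add: nth_yule_process)
    also have "\<dots> = yule_process Z \<pi> (?\<tau> i) \<omega> ! j" using const[OF u] by simp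
    finally show "skeleton Z \<pi> h k \<omega> ! j = yule_process Z \<pi> (?\<tau> i) \<omega> ! j" .
  qed (simp add: n)
qed

text \<open>Only the first few gaps between jumps matter, and they are finitely many and positive.
  Their minimum divided by 4 provides the gap of four meshes required by
  \<open>follows_eq_jump_chain\<close>.\<close>

lemma eventually_follows_imp_eq:
  assumes dist: "successively (\<noteq>) xs"
  shows "\<exists>h0>0. \<forall>h. 0 < h \<and> h < h0 \<longrightarrow> follows (\<lambda>k. skeleton Z \<pi> h k \<omega>) xs 0 \<longrightarrow>
    (\<forall>m<length xs. xs ! m = yule_process Z \<pi> (jump_time (yule_process Z \<pi>) m \<omega>) \<omega>)"
proof -
  let ?\<tau> = "\<lambda>t. jump_time (yule_process Z \<pi>) t \<omega>"
  define t where "t = length xs"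
  define h0 where "h0 = Min ((\<lambda>i. (?\<tau> (Suc i) - ?\<tau> i) / 4) ` {..t})"
  have "h0 > 0" unfolding h0_def using jump_time_strict by (subst Min_gr_iff) auto
  moreover have "xs ! m = yule_process Z \<pi> (?\<tau> m) \<omega>"
    if h: "0 < h" "h < h0" and fol: "follows (\<lambda>k. skeleton Z \<pi> h k \<omega>) xs 0" and m: "m < length xs"
    for h m
  proof -
    have gap: "?\<tau> i + 4 * h < ?\<tau> (Suc i)" if "i \<le> t" for i
    proof -
      have "h0 \<le> (?\<tau> (Suc i) - ?\<tau> i) / 4" unfolding h0_def using that by (intro Min_le) auto
      then show ?thesis using h by simp
    qed
    have "xs ! m = yule_process Z \<pi> (?\<tau> (0 + m)) \<omega>"
      by (rule follows_eq_jump_chain[where X = "\<lambda>k. skeleton Z \<pi> h k \<omega>" and k = 0 and h = h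
            and t = t and Y = "\<lambda>u. yule_process Z \<pi> u \<omega>" and \<tau> = ?\<tau> and xs = xs])
         (use h dist fol m jump_time_change in \<open>auto intro: jump_time_nonneg
            skeleton_eq_yule_process gap simp: t_def simp del: jump_time.simps(2)\<close>)
    then show ?thesis by simp
  qed
  ultimately show ?thesis by blast
qed

end

end

section \<open>Formation times on the grid\<close>

text \<open>Given \<open>U = x\<close>, the exponential variable has to exceed
  \<open>u + s - g x\<close>. This is nonnegative by \<open>gu\<close>, so the conditional
  probability is a pure exponential and \<open>exp (- r * s)\<close> leaves the integral over
  \<open>x\<close>. The map \<open>e\<close> is there because \<open>V\<close> will be the family
  \<pi> restricted to one index, evaluated by \<open>e\<close>.\<close>

lemma (in prob_space) exponential_memoryless_indep:
  assumes ind: "indep_var S U S' V" and e[measurable]: "e \<in> borel_measurable S'"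
    and E: "distributed M lborel (\<lambda>\<omega>. e (V \<omega>)) (exponential_density r)"
    and r: "r > 0" and C[measurable]: "Measurable.pred S C" and g[measurable]: "g \<in> borel_measurable S"
    and gu: "\<And>x. x \<in> space S \<Longrightarrow> C x \<Longrightarrow> g x \<le> u" and s: "s \<ge> 0"
  shows "\<P>(\<omega> in M. C (U \<omega>) \<and> u + s < g (U \<omega>) + e (V \<omega>)) =
    exp (- r * s) * \<P>(\<omega> in M. C (U \<omega>) \<and> u < g (U \<omega>) + e (V \<omega>))"
proof -
  have U[measurable]: "U \<in> M \<rightarrow>\<^sub>M S" and V[measurable]: "V \<in> M \<rightarrow>\<^sub>M S'"
    using indep_var_rv1[OF ind] indep_var_rv2[OF ind] by auto
  let ?DS = "distr M S U" and ?DE = "distr M S' V"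
  interpret DE: prob_space ?DE by (rule prob_space_distr) simp
  have joint: "?DS \<Otimes>\<^sub>M ?DE = distr M (S \<Otimes>\<^sub>M S') (\<lambda>\<omega>. (U \<omega>, V \<omega>))"
    using ind unfolding indep_var_distribution_eq by simp
  have tail: "emeasure M {\<omega>\<in>space M. C (U \<omega>) \<and> u + s < g (U \<omega>) + e (V \<omega>)} =
      (\<integral>\<^sup>+x. indicator {x\<in>space S. C x} x * ennreal (exp (- (u + s - g x) * r)) \<partial>?DS)"
    if s: "s \<ge> 0" for s
  proof -
    let ?A = "{p\<in>space (S \<Otimes>\<^sub>M S'). C (fst p) \<and> u + s < g (fst p) + e (snd p)}"
    have A: "?A \<in> sets (S \<Otimes>\<^sub>M S')" by measurable
    have "emeasure M {\<omega>\<in>space M. C (U \<omega>) \<and> u + s < g (U \<omega>) + e (V \<omega>)} =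
        emeasure (distr M (S \<Otimes>\<^sub>M S') (\<lambda>\<omega>. (U \<omega>, V \<omega>))) ?A"
      by (subst emeasure_distr)
         (auto intro!: arg_cong[where f = "emeasure M"] simp: space_pair_measure
               dest: measurable_space[OF U] measurable_space[OF V])
    also have "\<dots> = emeasure (?DS \<Otimes>\<^sub>M ?DE) ?A" by (simp add: joint)
    also have "\<dots> = (\<integral>\<^sup>+x. emeasure ?DE (Pair x -` ?A) \<partial>?DS)"
      by (rule DE.emeasure_pair_measure_alt) (use A in \<open>simp cong: sets_pair_measure_cong\<close>)
    also have "\<dots> = (\<integral>\<^sup>+x. indicator {x\<in>space S. C x} x * ennreal (exp (- (u + s - g x) * r)) \<partial>?DS)"
    proof (rule nn_integral_cong)
      fix x assume "x \<in> space ?DS"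
      then have x: "x \<in> space S" by simp
      show "emeasure ?DE (Pair x -` ?A) =
          indicator {x\<in>space S. C x} x * ennreal (exp (- (u + s - g x) * r))"
      proof (cases "C x")
        case True
        have "emeasure ?DE (Pair x -` ?A) = emeasure ?DE {v\<in>space S'. u + s - g x < e v}"
          using True x by (intro arg_cong2[where f = emeasure]) (auto simp: space_pair_measure)
        also have "\<dots> = emeasure M {\<omega>\<in>space M. u + s - g x < e (V \<omega>)}"
          by (subst emeasure_distr) (auto intro!: arg_cong[where f = "emeasure M"] dest: measurable_space[OF V])
        also have "\<dots> = ennreal (exp (- (u + s - g x) * r))"
          using exponential_distributedD_gt[OF E _ r, of "u + s - g x"] gu[OF x True] s
          by (simp add: emeasure_eq_measure)
        finally show ?thesis using True x by simp
      next
        case False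
        then have "Pair x -` ?A = {}" by auto
        then show ?thesis using False by simp
      qed
    qed
    finally show ?thesis .
  qed
  have "emeasure M {\<omega>\<in>space M. C (U \<omega>) \<and> u + s < g (U \<omega>) + e (V \<omega>)} =
      (\<integral>\<^sup>+x. ennreal (exp (- r * s)) *
        (indicator {x\<in>space S. C x} x * ennreal (exp (- (u + 0 - g x) * r))) \<partial>?DS)"
    unfolding tail[OF s]
  proof (rule nn_integral_cong)
    fix x
    have "exp (- (u + s - g x) * r) = exp (- r * s) * exp (- (u + 0 - g x) * r)"
      by (simp add: exp_add[symmetric] algebra_simps)
    then show "indicator {x\<in>space S. C x} x * ennreal (exp (- (u + s - g x) * r)) =
        ennreal (exp (- r * s)) *
          (indicator {x\<in>space S. C x} x * ennreal (exp (- (u + 0 - g x) * r)))"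
      by (simp add: ennreal_mult mult_ac)
  qed
  also have "\<dots> = ennreal (exp (- r * s)) *
      emeasure M {\<omega>\<in>space M. C (U \<omega>) \<and> u + 0 < g (U \<omega>) + e (V \<omega>)}"
    unfolding tail[OF order_refl] by (rule nn_integral_cmult) measurable
  finally show ?thesis
    by (simp add: emeasure_eq_measure ennreal_mult[symmetric])
qed

locale positive_yule_detachment = yule_detachment M l1 l2 m2 Z \<pi>
  for M :: "'a measure" and l1 l2 m2 :: real
    and Z :: "nat \<Rightarrow> real \<Rightarrow> 'a \<Rightarrow> nat" and \<pi> :: "nat \<Rightarrow> 'a \<Rightarrow> real" +
  assumes l1: "l1 > 0" and l2: "l2 > 0" and m2: "m2 \<ge> 0"
begin

lemma measurable_\<pi> [measurable]: "k \<ge> 1 \<Longrightarrow> \<pi> k \<in> borel_measurable M"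
  using distributed_measurable[OF exponential] by simp

lemma measurable_formation_time [measurable]: "formation_time \<pi> k \<in> borel_measurable M"
proof -
  have "formation_time \<pi> k = (\<lambda>\<omega>. \<Sum>i=1..k. \<pi> i \<omega>)" by (simp add: fun_eq_iff formation_time_def)
  also have "\<dots> \<in> borel_measurable M" by (intro borel_measurable_sum measurable_\<pi>) simp
  finally show ?thesis .
qed

lemma measurable_households [measurable]: "households \<pi> u \<in> M \<rightarrow>\<^sub>M count_space UNIV"
proof -
  have "households \<pi> u =
      (\<lambda>\<omega>. Suc (LEAST m. formation_time \<pi> m \<omega> \<le> u \<and> u < formation_time \<pi> (Suc m) \<omega>))"
    by (simp add: fun_eq_iff households_def)
  also have "\<dots> \<in> M \<rightarrow>\<^sub>M count_space UNIV" by measurable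
  finally show ?thesis .
qed

text \<open>For positive waiting times this says that there are \<open>l m\<close> households at
  each grid time. Written through formation times, it is visibly an event of the family \<pi>
  alone.\<close>

definition grid_event :: "real \<Rightarrow> (nat \<Rightarrow> nat) \<Rightarrow> nat \<Rightarrow> 'a \<Rightarrow> bool" where
  "grid_event h l k \<omega> \<longleftrightarrow> (\<forall>m\<le>k. formation_time \<pi> (l m - 1) \<omega> \<le> real m * h \<and>
     real m * h < formation_time \<pi> (l m) \<omega>)"

lemma measurable_grid_event [measurable]: "Measurable.pred M (grid_event h l k)"
  unfolding grid_event_def[abs_def] by measurable

text \<open>A lower bound for the conditional probability of passing from \<open>n\<close> to
  \<open>n'\<close> households within one mesh. After a formation the next waiting time is asked to
  exceed the whole mesh instead of its remainder, which makes this condition independent of the past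
  at a loss of second order in \<open>h\<close>. Several formations in one mesh are
  discarded.\<close>

definition birth_weight :: "real \<Rightarrow> nat \<Rightarrow> nat \<Rightarrow> real" where
  "birth_weight h n n' =
     (if n' = n then exp (- real n * l1 * h)
      else if n' = Suc n then (1 - exp (- real n * l1 * h)) * exp (- real (Suc n) * l1 * h)
      else 0)"

lemma birth_weight_nonneg: "h \<ge> 0 \<Longrightarrow> birth_weight h n n' \<ge> 0"
  using l1 by (simp add: birth_weight_def)

lemma indep_var_before:
  assumes "n \<ge> 1"
  shows "indep_var (PiM {1..<n} (\<lambda>_. borel)) (\<lambda>\<omega>. restrict (\<lambda>i. \<pi> i \<omega>) {1..<n})
    (PiM {n} (\<lambda>_. borel)) (\<lambda>\<omega>. restrict (\<lambda>i. \<pi> i \<omega>) {n})"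
  using assms by (intro indep_var_restrict[OF indep_\<pi>]) auto

text \<open>With \<open>n = l k\<close>, the grid event is a condition on the first
  \<open>n - 1\<close> waiting times together with the single requirement that formation time
  \<open>n\<close> exceeds \<open>real k * h\<close>. So the memoryless property of
  \<open>\<pi> n\<close> applies.\<close>

lemma grid_event_tail:
  assumes h: "h > 0" and lk: "\<And>m. m \<le> k \<Longrightarrow> 1 \<le> l m \<and> l m \<le> l k" and s: "s \<ge> 0"
  shows "\<P>(\<omega> in M. grid_event h l k \<omega> \<and> real k * h + s < formation_time \<pi> (l k) \<omega>) =
    exp (- real (l k) * l1 * s) * \<P>(\<omega> in M. grid_event h l k \<omega>)"
proof -
  define n where "n = l k"
  have n: "n \<ge> 1" using lk[of k] by (simp add: n_def)
  define U where "U \<omega> = restrict (\<lambda>i. \<pi> i \<omega>) {1..<n}" for \<omega>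
  define S where "S i x = (\<Sum>j=1..i. x j)" for i and x :: "nat \<Rightarrow> real"
  \<comment> \<open>Strict bounds with \<open>l m = n\<close> are left out, as they follow from the
    one at \<open>k\<close>. The clause for \<open>m = k\<close> bounds \<open>S (n - 1) x\<close>
    by \<open>real k * h\<close>, as the memoryless property requires.\<close>
  define C where "C x \<longleftrightarrow> (\<forall>m\<in>{..k}. S (l m - 1) x \<le> real m * h \<and>
     (l m < n \<longrightarrow> real m * h < S (l m) x))" for x
  have S[measurable]: "S i \<in> borel_measurable (PiM {1..<n} (\<lambda>_. borel))" if "i < n" for i
    unfolding S_def using that
    by (intro borel_measurable_sum measurable_component_singleton) auto
  have SU: "S i (U \<omega>) = formation_time \<pi> i \<omega>" if "i < n" for i \<omega>
    unfolding S_def U_def formation_time_def using that by (intro sum.cong) auto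
  have T: "formation_time \<pi> n \<omega> = S (n - 1) (U \<omega>) + \<pi> n \<omega>" for \<omega>
    using SU[of "n - 1" \<omega>] formation_time_Suc[of \<pi> "n - 1" \<omega>] n by simp
  have C: "grid_event h l k \<omega> \<longleftrightarrow> C (U \<omega>) \<and> real k * h < S (n - 1) (U \<omega>) + \<pi> n \<omega>" for \<omega>
  proof
    assume g: "grid_event h l k \<omega>"
    show "C (U \<omega>) \<and> real k * h < S (n - 1) (U \<omega>) + \<pi> n \<omega>"
    proof
      show "C (U \<omega>)" unfolding C_def
      proof (intro ballI conjI impI)
        fix m assume m: "m \<in> {..k}"
        then have "l m - 1 < n" using lk[of m] unfolding n_def by auto
        then show "S (l m - 1) (U \<omega>) \<le> real m * h" using g m by (simp add: SU grid_event_def)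
      next
        fix m assume "m \<in> {..k}" "l m < n"
        then show "real m * h < S (l m) (U \<omega>)" using g by (simp add: SU grid_event_def)
      qed
      show "real k * h < S (n - 1) (U \<omega>) + \<pi> n \<omega>"
        using g unfolding T[symmetric] by (simp add: n_def grid_event_def)
    qed
  next
    assume g: "C (U \<omega>) \<and> real k * h < S (n - 1) (U \<omega>) + \<pi> n \<omega>"
    show "grid_event h l k \<omega>" unfolding grid_event_def
    proof (intro allI impI conjI)
      fix m assume m: "m \<le> k"
      then have "l m - 1 < n" using lk[of m] unfolding n_def by auto
      then show "formation_time \<pi> (l m - 1) \<omega> \<le> real m * h"
        using g m by (simp add: SU[symmetric] C_def)
      show "real m * h < formation_time \<pi> (l m) \<omega>"
      proof (cases "l m < n")
        case True
        then show ?thesis using g m by (simp add: SU[symmetric] C_def)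
      next
        case False
        then have "l m = n" using lk[OF m] by (simp add: n_def)
        moreover have "real m * h \<le> real k * h" using m h by (intro mult_right_mono) auto
        ultimately show ?thesis using g T[of \<omega>] by simp
      qed
    qed
  qed
  define V where "V \<omega> = restrict (\<lambda>i. \<pi> i \<omega>) {n}" for \<omega>
  have V: "V \<omega> n = \<pi> n \<omega>" for \<omega> by (simp add: V_def)
  have "\<P>(\<omega> in M. C (U \<omega>) \<and> real k * h + s < S (n - 1) (U \<omega>) + V \<omega> n) =
      exp (- (real n * l1) * s) * \<P>(\<omega> in M. C (U \<omega>) \<and> real k * h < S (n - 1) (U \<omega>) + V \<omega> n)"
  proof (rule exponential_memoryless_indep[where U = U and V = V and e = "\<lambda>f. f n"
        and g = "S (n - 1)" and C = C])
    show "indep_var (PiM {1..<n} (\<lambda>_. borel)) U (PiM {n} (\<lambda>_. borel)) V"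
      using indep_var_before[OF n] unfolding U_def[abs_def] V_def[abs_def] by simp
    show "(\<lambda>f. f n) \<in> borel_measurable (PiM {n} (\<lambda>_. borel))"
      by (rule measurable_component_singleton) simp
    show "distributed M lborel (\<lambda>\<omega>. V \<omega> n) (exponential_density (real n * l1))"
      using exponential[OF n] by (simp add: V)
    show "real n * l1 > 0" using n l1 by simp
    have "Measurable.pred (PiM {1..<n} (\<lambda>_. borel)) (\<lambda>x. S (l m - 1) x \<le> real m * h \<and>
        (l m < n \<longrightarrow> real m * h < S (l m) x))" if "m \<in> {..k}" for m
    proof -
      have "l m - 1 < n" using lk[of m] that unfolding n_def by auto
      note S[OF this, measurable]
      show ?thesis
      proof (cases "l m < n")
        case True
        note S[OF this, measurable]
        show ?thesis by measurable
      next
        case False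
        have "Measurable.pred (PiM {1..<n} (\<lambda>_. borel)) (\<lambda>x. S (l m - 1) x \<le> real m * h)"
          by measurable
        then show ?thesis using False by simp
      qed
    qed
    then show "Measurable.pred (PiM {1..<n} (\<lambda>_. borel)) C"
      unfolding C_def[abs_def] by (intro pred_intros_finite) auto
    show "S (n - 1) \<in> borel_measurable (PiM {1..<n} (\<lambda>_. borel))" using n by (intro S) simp
    show "S (n - 1) x \<le> real k * h" if "C x" for x using that unfolding C_def n_def by auto
  qed (rule s)
  moreover have "grid_event h l k \<omega> \<and> real k * h + s < formation_time \<pi> (l k) \<omega> \<longleftrightarrow>
      C (U \<omega>) \<and> real k * h + s < S (n - 1) (U \<omega>) + \<pi> n \<omega>" for \<omega>
    using C[of \<omega>] T[of \<omega>] s unfolding n_def by auto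
  ultimately show ?thesis by (simp add: C V[unfolded n_def] n_def)
qed

text \<open>If the number of households stays, the weight is the tail just computed. If it grows,
  \<open>?A\<close> concerns the waiting times up to \<open>?n\<close> and is independent of
  \<open>h < \<pi> (Suc ?n)\<close>. Formation \<open>?n\<close> comes after
  \<open>real k * h\<close>, so the latter condition pushes the next formation beyond
  \<open>real (Suc k) * h\<close>.\<close>

lemma prob_grid_event_Suc:
  assumes h: "h > 0" and lk: "\<And>m. m \<le> k \<Longrightarrow> 1 \<le> l m \<and> l m \<le> l k"
    and lS: "l (Suc k) \<in> {l k, Suc (l k)}"
  shows "\<P>(\<omega> in M. grid_event h l k \<omega>) * birth_weight h (l k) (l (Suc k)) \<le>
    \<P>(\<omega> in M. grid_event h l (Suc k) \<omega>)"
proof -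
  let ?T = "formation_time \<pi>" and ?n = "l k"
  have n: "?n \<ge> 1" using lk[of k] by simp
  have Suc_iff: "grid_event h l (Suc k) \<omega> \<longleftrightarrow> grid_event h l k \<omega> \<and>
      ?T (l (Suc k) - 1) \<omega> \<le> real (Suc k) * h \<and> real (Suc k) * h < ?T (l (Suc k)) \<omega>" for \<omega>
    unfolding grid_event_def by (auto simp: le_Suc_eq)
  have tail: "\<P>(\<omega> in M. grid_event h l k \<omega> \<and> real (Suc k) * h < ?T ?n \<omega>) =
      exp (- real ?n * l1 * h) * \<P>(\<omega> in M. grid_event h l k \<omega>)"
    using grid_event_tail[where l = l and k = k and h = h and s = h] lk h by (simp add: algebra_simps)
  show ?thesis
  proof (cases "l (Suc k) = ?n")
    case True
    have "\<P>(\<omega> in M. grid_event h l k \<omega>) * birth_weight h ?n (l (Suc k)) =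
        \<P>(\<omega> in M. grid_event h l k \<omega> \<and> real (Suc k) * h < ?T ?n \<omega>)"
      unfolding tail by (simp add: birth_weight_def True)
    also have "\<dots> \<le> \<P>(\<omega> in M. grid_event h l (Suc k) \<omega>)"
    proof (rule finite_measure_mono)
      show "{\<omega>\<in>space M. grid_event h l k \<omega> \<and> real (Suc k) * h < ?T ?n \<omega>} \<subseteq>
          {\<omega>\<in>space M. grid_event h l (Suc k) \<omega>}"
      proof safe
        fix \<omega> assume g: "grid_event h l k \<omega>" "real (Suc k) * h < ?T ?n \<omega>"
        have "?T (?n - 1) \<omega> \<le> real k * h" using g by (simp add: grid_event_def)
        also have "\<dots> \<le> real (Suc k) * h" using h by (intro mult_right_mono) auto
        finally show "grid_event h l (Suc k) \<omega>" using g unfolding Suc_iff True by simp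
      qed
    qed measurable
    finally show ?thesis .
  next
    case False
    then have lSk: "l (Suc k) = Suc ?n" using lS by simp
    let ?A = "\<lambda>\<omega>. grid_event h l k \<omega> \<and> ?T ?n \<omega> \<le> real (Suc k) * h"
    have "\<P>(\<omega> in M. ?A \<omega>) = \<P>(\<omega> in M. grid_event h l k \<omega>) -
        \<P>(\<omega> in M. grid_event h l k \<omega> \<and> real (Suc k) * h < ?T ?n \<omega>)"
      by (subst finite_measure_Diff[symmetric]) (auto intro!: arg_cong[where f = prob])
    then have A: "\<P>(\<omega> in M. ?A \<omega>) =
        \<P>(\<omega> in M. grid_event h l k \<omega>) * (1 - exp (- real ?n * l1 * h))"
      unfolding tail by (simp add: algebra_simps)
    define U where "U \<omega> = restrict (\<lambda>i. \<pi> i \<omega>) {1..<Suc ?n}" for \<omega>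
    define S where "S i x = (\<Sum>j=1..i. x j)" for i and x :: "nat \<Rightarrow> real"
    define C where "C x \<longleftrightarrow> (\<forall>m\<in>{..k}. S (l m - 1) x \<le> real m * h \<and> real m * h < S (l m) x) \<and>
       S ?n x \<le> real (Suc k) * h" for x
    have S[measurable]: "S i \<in> borel_measurable (PiM {1..<Suc ?n} (\<lambda>_. borel))" if "i \<le> ?n" for i
      unfolding S_def using that
      by (intro borel_measurable_sum measurable_component_singleton) auto
    have SU: "S i (U \<omega>) = ?T i \<omega>" if "i \<le> ?n" for i \<omega>
      unfolding S_def U_def formation_time_def using that by (intro sum.cong) auto
    have CA: "C (U \<omega>) \<longleftrightarrow> ?A \<omega>" for \<omega>
      unfolding C_def grid_event_def using lk SU[of _ \<omega>] by (simp add: le_diff_conv le_SucI Ball_def)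
    have C: "Measurable.pred (PiM {1..<Suc ?n} (\<lambda>_. borel)) C"
    proof -
      have "Measurable.pred (PiM {1..<Suc ?n} (\<lambda>_. borel))
          (\<lambda>x. S (l m - 1) x \<le> real m * h \<and> real m * h < S (l m) x)" if "m \<in> {..k}" for m
      proof -
        have "l m - 1 \<le> ?n" "l m \<le> ?n" using lk[of m] that by auto
        note this[THEN S, measurable]
        show ?thesis by measurable
      qed
      then have 1: "Measurable.pred (PiM {1..<Suc ?n} (\<lambda>_. borel))
          (\<lambda>x. \<forall>m\<in>{..k}. S (l m - 1) x \<le> real m * h \<and> real m * h < S (l m) x)"
        by (intro pred_intros_finite) auto
      have "S ?n \<in> borel_measurable (PiM {1..<Suc ?n} (\<lambda>_. borel))" by (rule S) simp
      then have 2: "Measurable.pred (PiM {1..<Suc ?n} (\<lambda>_. borel)) (\<lambda>x. S ?n x \<le> real (Suc k) * h)"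
        by measurable
      show ?thesis unfolding C_def[abs_def] by (rule pred_intros_logic(3)[OF 1 2])
    qed
    define V where "V \<omega> = restrict (\<lambda>i. \<pi> i \<omega>) {Suc ?n}" for \<omega>
    have iv: "indep_var (PiM {1..<Suc ?n} (\<lambda>_. borel)) U (PiM {Suc ?n} (\<lambda>_. borel)) V"
      using indep_var_before[of "Suc ?n"] unfolding U_def[abs_def] V_def[abs_def] by simp
    have U: "U \<omega> \<in> space (PiM {1..<Suc ?n} (\<lambda>_. borel))" for \<omega>
      by (simp add: U_def space_PiM)
    have V: "V \<omega> \<in> space (PiM {Suc ?n} (\<lambda>_. borel))" "V \<omega> (Suc ?n) = \<pi> (Suc ?n) \<omega>" for \<omega>
      by (simp_all add: V_def space_PiM)
    have [measurable]: "(\<lambda>f. f (Suc ?n)) \<in> borel_measurable (PiM {Suc ?n} (\<lambda>_. borel))"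
      by (rule measurable_component_singleton) simp
    let ?B = "{x\<in>space (PiM {1..<Suc ?n} (\<lambda>_. borel)). C x}"
      and ?D = "{f\<in>space (PiM {Suc ?n} (\<lambda>_. borel)). h < f (Suc ?n)}"
    have "\<P>(\<omega> in M. ?A \<omega> \<and> h < \<pi> (Suc ?n) \<omega>) =
        prob ((\<lambda>\<omega>. (U \<omega>, V \<omega>)) -` (?B \<times> ?D) \<inter> space M)"
      by (intro arg_cong[where f = prob])
         (auto simp: CA U V simp del: One_nat_def)
    also have "\<dots> = prob (U -` ?B \<inter> space M) * prob (V -` ?D \<inter> space M)"
      by (rule indep_varD[OF iv]) (use C in \<open>auto simp: pred_def\<close>)
    also have "prob (U -` ?B \<inter> space M) = \<P>(\<omega> in M. ?A \<omega>)"
      by (intro arg_cong[where f = prob]) (auto simp: CA U simp del: One_nat_def)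
    also have "prob (V -` ?D \<inter> space M) = \<P>(\<omega> in M. h < \<pi> (Suc ?n) \<omega>)"
      by (intro arg_cong[where f = prob]) (auto simp: V)
    also have "\<dots> = exp (- real (Suc ?n) * l1 * h)"
    proof -
      have r: "real (Suc ?n) * l1 > 0" using l1 by simp
      show ?thesis
        using exponential_distributedD_gt[OF exponential[of "Suc ?n"] _ r, of h] h
        by (simp add: algebra_simps)
    qed
    finally have "\<P>(\<omega> in M. grid_event h l k \<omega>) * birth_weight h ?n (l (Suc k)) =
        \<P>(\<omega> in M. ?A \<omega> \<and> h < \<pi> (Suc ?n) \<omega>)"
      unfolding A by (simp add: birth_weight_def lSk)
    also have "\<dots> \<le> \<P>(\<omega> in M. grid_event h l (Suc k) \<omega>)"
    proof (rule finite_measure_mono)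
      show "{\<omega>\<in>space M. ?A \<omega> \<and> h < \<pi> (Suc ?n) \<omega>} \<subseteq> {\<omega>\<in>space M. grid_event h l (Suc k) \<omega>}"
      proof safe
        fix \<omega> assume g: "grid_event h l k \<omega>" "?T ?n \<omega> \<le> real (Suc k) * h" "h < \<pi> (Suc ?n) \<omega>"
        have "real k * h < ?T ?n \<omega>" using g by (simp add: grid_event_def)
        then have "real (Suc k) * h < ?T (Suc ?n) \<omega>"
          using g unfolding formation_time_Suc by (simp add: algebra_simps)
        then show "grid_event h l (Suc k) \<omega>" using g unfolding Suc_iff lSk by simp
      qed
    qed measurable
    finally show ?thesis .
  qed
qed

end

section \<open>Path probabilities of the skeleton\<close>

lemma measurable_map_upt:
  fixes g :: "nat \<Rightarrow> 'a \<Rightarrow> 's :: countable"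
  assumes n: "n \<in> M \<rightarrow>\<^sub>M count_space UNIV" and g: "\<And>j. g j \<in> M \<rightarrow>\<^sub>M count_space UNIV"
  shows "(\<lambda>\<omega>. map (\<lambda>j. g j \<omega>) [0..<n \<omega>]) \<in> M \<rightarrow>\<^sub>M count_space UNIV"
proof (rule measurable_compose_countable[where f = "\<lambda>n \<omega>. map (\<lambda>j. g j \<omega>) [0..<n]", OF _ n])
  fix n
  show "(\<lambda>\<omega>. map (\<lambda>j. g j \<omega>) [0..<n]) \<in> M \<rightarrow>\<^sub>M count_space UNIV"
    unfolding measurable_count_space_eq2_countable
  proof (intro conjI ballI)
    fix y :: "'s list"
    have "(\<lambda>\<omega>. map (\<lambda>j. g j \<omega>) [0..<n]) -` {y} \<inter> space M =
        {\<omega>\<in>space M. length y = n \<and> (\<forall>j\<in>{..<n}. g j \<omega> = y ! j)}"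
    proof (intro set_eqI)
      fix \<omega>
      have "map (\<lambda>j. g j \<omega>) [0..<n] = y \<longleftrightarrow> length y = n \<and> (\<forall>j\<in>{..<n}. g j \<omega> = y ! j)"
        by (subst list_eq_iff_nth_eq) (simp, blast)
      then show "\<omega> \<in> (\<lambda>\<omega>. map (\<lambda>j. g j \<omega>) [0..<n]) -` {y} \<inter> space M \<longleftrightarrow>
          \<omega> \<in> {\<omega>\<in>space M. length y = n \<and> (\<forall>j\<in>{..<n}. g j \<omega> = y ! j)}" by blast
    qed
    also have "\<dots> \<in> sets M"
    proof -
      note g[measurable]
      show ?thesis by measurable
    qed
    finally show "(\<lambda>\<omega>. map (\<lambda>j. g j \<omega>) [0..<n]) -` {y} \<inter> space M \<in> sets M" .
  qed auto
qed

section \<open>Measurability and product formulas for the household sizes\<close>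

context positive_yule_detachment
begin

lemma markov_chain_Z: "j \<ge> 1 \<Longrightarrow> right_continuous_markov_chain M (birth_death_generator l2 m2) (Z j)"
  using birth_death unfolding birth_death_process_from_one_def by blast

lemma measurable_Z: "j \<ge> 1 \<Longrightarrow> u \<ge> 0 \<Longrightarrow> Z j u \<in> M \<rightarrow>\<^sub>M count_space UNIV"
  by (rule right_continuous_markov_chain.measurable_X[OF markov_chain_Z])

lemma right_constant_Z:
  assumes "j \<ge> 1" "\<omega> \<in> space M"
  shows "right_constant (\<lambda>u. Z j u \<omega>)"
  by (rule right_constant_if_right_continuous)
     (rule right_continuous_markov_chain.right_continuous[OF markov_chain_Z[OF assms(1)] assms(2)])

lemma Z_start: "j \<ge> 1 \<Longrightarrow> AE \<omega> in M. Z j 0 \<omega> = 1"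
  by (rule birth_death_process_from_one.start[OF birth_death])

lemma AE_\<pi>_pos: "AE \<omega> in M. \<forall>k\<ge>1. \<pi> k \<omega> > 0"
proof -
  have "AE \<omega> in M. k \<ge> 1 \<longrightarrow> \<pi> k \<omega> > 0" for k
  proof (cases "k \<ge> 1")
    case True
    note [measurable] = measurable_\<pi>[OF True]
    have "real k * l1 > 0" using True l1 by simp
    then have "\<P>(\<omega> in M. 0 < \<pi> k \<omega>) = 1"
      using exponential_distributedD_gt[OF exponential[OF True], of 0] by simp
    then have "AE \<omega> in M. 0 < \<pi> k \<omega>" by (subst (asm) prob_Collect_eq_1) auto
    then show ?thesis by simp
  qed simp
  then show ?thesis by (subst AE_all_countable) auto
qed

lemma measurable_skeleton: "h > 0 \<Longrightarrow> skeleton Z \<pi> h k \<in> M \<rightarrow>\<^sub>M count_space UNIV"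
proof -
  assume h: "h > 0"
  have "(\<lambda>\<omega>. Z (Suc j) (real (k - nat \<lceil>formation_time \<pi> j \<omega> / h\<rceil>) * h) \<omega>) \<in> M \<rightarrow>\<^sub>M count_space UNIV"
    for j
    by (rule measurable_compose_countable[where f = "\<lambda>i. Z (Suc j) (real (k - i) * h)"])
       (use h in \<open>auto intro!: measurable_Z\<close>)
  then show ?thesis unfolding skeleton_def[abs_def] by (intro measurable_map_upt) auto
qed

text \<open>Existing households have nonnegative age, so \<open>max 0\<close> changes nothing in the
  list. It makes each coordinate a measurable function of the sample point even where the household
  does not exist yet.\<close>

lemma yule_process_eq_map:
  "u \<ge> 0 \<Longrightarrow> yule_process Z \<pi> u \<omega> =
     map (\<lambda>j. Z (Suc j) (max 0 (u - formation_time \<pi> j \<omega>)) \<omega>) [0..<households \<pi> u \<omega>]"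
  by (rule nth_equalityI) (auto simp: nth_yule_process formation_time_le)

lemma measurable_yule_process:
  assumes "u \<ge> 0"
  shows "yule_process Z \<pi> u \<in> M \<rightarrow>\<^sub>M count_space UNIV"
proof -
  have "(\<lambda>\<omega>. Z (Suc j) (max 0 (u - formation_time \<pi> j \<omega>)) \<omega>) \<in> M \<rightarrow>\<^sub>M count_space UNIV" for j
    by (rule measurable_at_random_time) (auto intro: measurable_Z right_constant_Z)
  moreover have "yule_process Z \<pi> u =
      (\<lambda>\<omega>. map (\<lambda>j. Z (Suc j) (max 0 (u - formation_time \<pi> j \<omega>)) \<omega>) [0..<households \<pi> u \<omega>])"
    using yule_process_eq_map[OF assms] by (simp add: fun_eq_iff)
  ultimately show ?thesis by (simp add: measurable_map_upt)
qed

definition jump_chain :: "nat \<Rightarrow> 'a \<Rightarrow> nat list" where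
  "jump_chain t \<omega> = yule_process Z \<pi> (jump_time (yule_process Z \<pi>) t \<omega>) \<omega>"

lemma measurable_jump_chain [measurable]: "jump_chain t \<in> M \<rightarrow>\<^sub>M count_space UNIV"
proof -
  have rc: "right_constant (\<lambda>u. yule_process Z \<pi> u \<omega>)" if "\<omega> \<in> space M" for \<omega>
    by (rule right_constant_yule_process) (rule right_constant_Z[OF _ that])
  show ?thesis unfolding jump_chain_def[abs_def]
    by (rule measurable_at_random_time[OF measurable_yule_process rc])
       (auto intro: measurable_jump_time[OF measurable_yule_process rc] jump_time_nonneg)
qed

lemma jump_chain_in_states: "jump_chain t \<omega> \<in> states"
  using households_pos unfolding jump_chain_def states_def
  by (metis (mono_tags) length_0_conv length_yule_process mem_Collect_eq not_one_le_zero)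

text \<open>For each process a transition function is only known to exist, and a priori the choice
  may depend on \<open>j\<close>. In the limit of small mesh the common generator is all that
  remains of it.\<close>

definition trans :: "nat \<Rightarrow> real \<Rightarrow> nat \<Rightarrow> nat \<Rightarrow> real" where
  "trans j = (SOME p. transition_function p \<and>
      infinitesimal_generator p (birth_death_generator l2 m2) \<and>
      (\<forall>n (t :: nat \<Rightarrow> real) (x :: nat \<Rightarrow> nat) y.
         0 \<le> t 0 \<and> (\<forall>k\<le>n. t k < t (Suc k)) \<and> \<P>(\<omega> in M. \<forall>k\<le>n. Z j (t k) \<omega> = x k) > 0 \<longrightarrow>
         \<P>(\<omega> in M. Z j (t (Suc n)) \<omega> = y \<bar> \<forall>k\<le>n. Z j (t k) \<omega> = x k) =
           p (t (Suc n) - t n) (x n) y))"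

lemma trans:
  assumes "j \<ge> 1"
  shows transition_function_trans: "transition_function (trans j)"
    and generator_trans: "infinitesimal_generator (trans j) (birth_death_generator l2 m2)"
    and markov_trans: "\<And>n (t :: nat \<Rightarrow> real) x y. 0 \<le> t 0 \<Longrightarrow> (\<And>k. k \<le> n \<Longrightarrow> t k < t (Suc k)) \<Longrightarrow>
         \<P>(\<omega> in M. \<forall>k\<le>n. Z j (t k) \<omega> = x k) > 0 \<Longrightarrow>
         \<P>(\<omega> in M. Z j (t (Suc n)) \<omega> = y \<bar> \<forall>k\<le>n. Z j (t k) \<omega> = x k) =
           trans j (t (Suc n) - t n) (x n) y"
proof -
  note * = someI_ex[OF right_continuous_markov_chain.markov[OF markov_chain_Z[OF assms]],
      folded trans_def]
  show "transition_function (trans j)" "infinitesimal_generator (trans j) (birth_death_generator l2 m2)"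
    using * by blast+
  show "\<P>(\<omega> in M. Z j (t (Suc n)) \<omega> = y \<bar> \<forall>k\<le>n. Z j (t k) \<omega> = x k) =
      trans j (t (Suc n) - t n) (x n) y"
    if "0 \<le> t 0" "\<And>k. k \<le> n \<Longrightarrow> t k < t (Suc k)" "\<P>(\<omega> in M. \<forall>k\<le>n. Z j (t k) \<omega> = x k) > 0"
    for n x y and t :: "nat \<Rightarrow> real"
    using * that by blast
qed

lemma prob_Z_grid:
  assumes j: "j \<ge> 1" and h: "h > 0"
  shows "\<P>(\<omega> in M. \<forall>i\<le>n. Z j (real i * h) \<omega> = z i) =
    of_bool (z 0 = 1) * (\<Prod>i<n. trans j h (z i) (z (Suc i)))"
proof (induction n)
  case 0
  have Z0: "AE \<omega> in M. Z j 0 \<omega> = 1" by (rule Z_start[OF j])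
  have [measurable]: "Z j 0 \<in> M \<rightarrow>\<^sub>M count_space UNIV" by (rule measurable_Z) (use j in auto)
  have "\<P>(\<omega> in M. Z j 0 \<omega> = z 0) = of_bool (z 0 = 1)"
  proof (cases "z 0 = 1")
    case True
    then show ?thesis using Z0 by (simp add: prob_Collect_eq_1)
  next
    case False
    then have "AE \<omega> in M. Z j 0 \<omega> \<noteq> z 0" using Z0 by auto
    then show ?thesis using False by (simp add: prob_Collect_eq_0)
  qed
  then show ?case by simp
next
  case (Suc n)
  have Zi: "Measurable.pred M (\<lambda>\<omega>. Z j (real i * h) \<omega> = z i)" for i
  proof -
    have "Z j (real i * h) \<in> M \<rightarrow>\<^sub>M count_space UNIV" by (rule measurable_Z) (use j h in auto)
    from measurable_sets[OF this, of "{z i}"] show ?thesis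
      by (simp add: pred_def vimage_def Int_def conj_commute)
  qed
  let ?P = "\<P>(\<omega> in M. \<forall>i\<le>n. Z j (real i * h) \<omega> = z i)"
  have eq: "\<P>(\<omega> in M. \<forall>i\<le>Suc n. Z j (real i * h) \<omega> = z i) =
      \<P>(\<omega> in M. Z j (real (Suc n) * h) \<omega> = z (Suc n) \<and> (\<forall>i\<le>n. Z j (real i * h) \<omega> = z i))"
    by (intro arg_cong[where f = prob]) (auto simp: le_Suc_eq)
  show ?case
  proof (cases "?P > 0")
    case True
    have "\<P>(\<omega> in M. Z j (real (Suc n) * h) \<omega> = z (Suc n) \<bar> \<forall>i\<le>n. Z j (real i * h) \<omega> = z i) =
        trans j (real (Suc n) * h - real n * h) (z n) (z (Suc n))"
      by (rule markov_trans[OF j, where t = "\<lambda>i. real i * h"]) (use True h in auto)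
    then have "\<P>(\<omega> in M. \<forall>i\<le>Suc n. Z j (real i * h) \<omega> = z i) = trans j h (z n) (z (Suc n)) * ?P"
      using True unfolding eq cond_prob_def by (simp add: field_simps)
    then show ?thesis unfolding Suc.IH by simp
  next
    \<comment> \<open>The Markov property speaks about conditioning events of positive probability
      only; for a null event both sides vanish.\<close>
    case False
    then have P0: "?P = 0" by (intro antisym measure_nonneg) simp
    have "\<P>(\<omega> in M. \<forall>i\<le>Suc n. Z j (real i * h) \<omega> = z i) \<le> ?P"
      unfolding eq
    proof (intro finite_measure_mono Collect_mono impI)
      show "{\<omega>\<in>space M. \<forall>i\<le>n. Z j (real i * h) \<omega> = z i} \<in> events"
        unfolding pred_def[symmetric] by (intro pred_intros_countable pred_intros_imp' Zi)
    qed (elim conjE, intro conjI, assumption+)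
    then have "\<P>(\<omega> in M. \<forall>i\<le>Suc n. Z j (real i * h) \<omega> = z i) = 0"
      unfolding P0 by (intro antisym measure_nonneg)
    moreover have "of_bool (z 0 = 1) * (\<Prod>i<n. trans j h (z i) (z (Suc i))) = 0"
      using Suc.IH P0 by simp
    ultimately show ?thesis by auto
  qed
qed

text \<open>Independence enters twice: between the family of all \<open>Z j\<close> and the family
  \<pi>, then among the \<open>Z j\<close>. For the former, both events are written as preimages
  under the joint maps \<open>?F\<close> and \<open>?G\<close>.\<close>

lemma prob_grid_event_and_paths:
  assumes J: "finite J" "J \<noteq> {}" "J \<subseteq> {1..}"
    and B: "\<And>j. j \<in> J \<Longrightarrow> B j \<in> sets (\<Pi>\<^sub>M u\<in>{0::real..}. count_space (UNIV :: nat set))"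
  shows "\<P>(\<omega> in M. grid_event h l k \<omega> \<and> (\<forall>j\<in>J. (\<lambda>u\<in>{0..}. Z j u \<omega>) \<in> B j)) =
    \<P>(\<omega> in M. grid_event h l k \<omega>) * (\<Prod>j\<in>J. \<P>(\<omega> in M. (\<lambda>u\<in>{0..}. Z j u \<omega>) \<in> B j))"
proof -
  let ?P = "\<Pi>\<^sub>M u\<in>{0::real..}. count_space (UNIV :: nat set)"
  let ?F = "\<lambda>\<omega>. \<lambda>j\<in>{1..}. \<lambda>u\<in>{0..}. Z j u \<omega>" and ?G = "\<lambda>\<omega>. \<lambda>k\<in>{1..}. \<pi> k \<omega>"
  define a where "a = {\<omega>\<in>space M. \<forall>j\<in>J. (\<lambda>u\<in>{0..}. Z j u \<omega>) \<in> B j}"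
  define b where "b = {\<omega>\<in>space M. grid_event h l k \<omega>}"
  let ?A = "{f\<in>space (\<Pi>\<^sub>M j\<in>{1::nat..}. ?P). \<forall>j\<in>J. f j \<in> B j}"
  have "?A \<in> sets (\<Pi>\<^sub>M j\<in>{1::nat..}. ?P)"
  proof -
    have "{f\<in>space (\<Pi>\<^sub>M j\<in>{1::nat..}. ?P). f j \<in> B j} \<in> sets (\<Pi>\<^sub>M j\<in>{1::nat..}. ?P)" if "j \<in> J" for j
    proof -
      have "(\<lambda>f. f j) \<in> (\<Pi>\<^sub>M j\<in>{1::nat..}. ?P) \<rightarrow>\<^sub>M ?P"
        using J that by (intro measurable_component_singleton) auto
      from measurable_sets[OF this B[OF that]] show ?thesis by (simp add: vimage_def Int_def conj_commute)
    qed
    then show ?thesis using J(1) by (intro sets.sets_Collect_finite_All)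
  qed
  then have "?F -` ?A \<inter> space M \<in> sets (vimage_algebra (space M) ?F (\<Pi>\<^sub>M j\<in>{1::nat..}. ?P))"
    by (rule in_vimage_algebra)
  moreover have "?F -` ?A \<inter> space M = a"
    unfolding a_def using J(3) by (auto simp: space_PiM subset_eq)
  ultimately have a: "a \<in> sets (vimage_algebra (space M) ?F (\<Pi>\<^sub>M j\<in>{1::nat..}. ?P))" by simp
  define S where "S i x = (\<Sum>j=1..i. x j)" for i and x :: "nat \<Rightarrow> real"
  have [measurable]: "S i \<in> borel_measurable (PiM {1..} (\<lambda>_. borel))" for i
    unfolding S_def
    by (intro borel_measurable_sum measurable_component_singleton) auto
  have SG: "S i (?G \<omega>) = formation_time \<pi> i \<omega>" for i \<omega>
    unfolding S_def formation_time_def by (intro sum.cong) auto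
  let ?B = "{x\<in>space (PiM {1..} (\<lambda>_. borel)). \<forall>m\<le>k. S (l m - 1) x \<le> real m * h \<and>
     real m * h < S (l m) x}"
  have "?B \<in> sets (PiM {1..} (\<lambda>_. borel))" by measurable
  then have "?G -` ?B \<inter> space M \<in> sets (vimage_algebra (space M) ?G (PiM {1..} (\<lambda>_. borel)))"
    by (rule in_vimage_algebra)
  moreover have "?G -` ?B \<inter> space M = b"
    unfolding b_def grid_event_def using SG by (auto simp: space_PiM)
  ultimately have b: "b \<in> sets (vimage_algebra (space M) ?G (PiM {1..} (\<lambda>_. borel)))" by simp
  have "prob (a \<inter> b) = prob a * prob b" by (rule indep_setD[OF indep_Z_\<pi> a b])
  moreover have "prob a = (\<Prod>j\<in>J. \<P>(\<omega> in M. (\<lambda>u\<in>{0..}. Z j u \<omega>) \<in> B j))"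
  proof -
    have "a = (\<Inter>j\<in>J. (\<lambda>\<omega>. \<lambda>u\<in>{0..}. Z j u \<omega>) -` B j \<inter> space M)"
      unfolding a_def using J(2) by auto
    also have "prob \<dots> = (\<Prod>j\<in>J. prob ((\<lambda>\<omega>. \<lambda>u\<in>{0..}. Z j u \<omega>) -` B j \<inter> space M))"
      by (rule indep_varsD[OF indep_Z J(2,1,3) B])
    also have "\<dots> = (\<Prod>j\<in>J. \<P>(\<omega> in M. (\<lambda>u\<in>{0..}. Z j u \<omega>) \<in> B j))"
      by (intro prod.cong arg_cong[where f = prob]) auto
    finally show ?thesis .
  qed
  moreover have "{\<omega>\<in>space M. grid_event h l k \<omega> \<and> (\<forall>j\<in>J. (\<lambda>u\<in>{0..}. Z j u \<omega>) \<in> B j)} = a \<inter> b"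
    unfolding a_def b_def by auto
  ultimately show ?thesis unfolding b_def by (simp add: mult.commute)
qed

text \<open>Existing households evolve for a time \<open>h\<close>, and the number of households for
  one mesh. A new household is counted from the grid time to which its formation is rounded up,
  where its age is 0; hence its size must be 1.\<close>

definition step_weight :: "real \<Rightarrow> nat list \<Rightarrow> nat list \<Rightarrow> real" where
  "step_weight h x y = birth_weight h (length x) (length y) *
     (\<Prod>j<length x. trans (Suc j) h (x ! j) (y ! j)) *
     of_bool (length x < length y \<longrightarrow> y ! length x = 1)"

lemma trans_nonneg: "j \<ge> 1 \<Longrightarrow> h \<ge> 0 \<Longrightarrow> trans j h x y \<ge> 0"
  using transition_function_trans[of j] by (simp add: transition_function_def)

lemma step_weight_nonneg: "h \<ge> 0 \<Longrightarrow> step_weight h x y \<ge> 0"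
  unfolding step_weight_def by (intro mult_nonneg_nonneg prod_nonneg birth_weight_nonneg)
    (auto intro: trans_nonneg)

text \<open>On the grid event, entry \<open>j\<close> joins the skeleton at a deterministic index
  and from then on is \<open>Z (Suc j)\<close> read at multiples of \<open>h\<close>. Thus the path
  event contains, up to a null set, an intersection of independent events, and the product over
  steps is regrouped into a product over households.\<close>

lemma prob_skeleton_path:
  assumes h: "h > 0" and y0: "y 0 = [1]"
  shows "(\<Prod>m<k. step_weight h (y m) (y (Suc m))) \<le> \<P>(\<omega> in M. \<forall>m\<le>k. skeleton Z \<pi> h m \<omega> = y m)"
proof (cases "\<exists>m<k. step_weight h (y m) (y (Suc m)) = 0")
  case True
  then have "(\<Prod>m<k. step_weight h (y m) (y (Suc m))) = 0" by (intro prod_zero) auto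
  then show ?thesis by (simp only: measure_nonneg)
next
  case False
  define l where "l m = length (y m)" for m
  \<comment> \<open>Nonvanishing weights force the list to lengthen by at most one entry per step,
    each new entry being 1.\<close>
  have lS: "l (Suc m) \<in> {l m, Suc (l m)}" "l m < l (Suc m) \<longrightarrow> y (Suc m) ! l m = 1"
    "step_weight h (y m) (y (Suc m)) = birth_weight h (l m) (l (Suc m)) *
       (\<Prod>j<l m. trans (Suc j) h (y m ! j) (y (Suc m) ! j))" if "m < k" for m
    using False that unfolding step_weight_def l_def birth_weight_def
    by (auto split: if_splits simp: of_bool_def)
  have mono: "l m \<le> l m'" if "m \<le> m'" "m' \<le> k" for m m'
    using that
  proof (induction m' rule: dec_induct)
    case (step n)
    then show ?case using lS(1)[of n] by auto
  qed simp
  have l0: "l 0 = 1" by (simp add: l_def y0)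
  have l1: "l m \<ge> 1" if "m \<le> k" for m using mono[of 0 m] l0 that by simp
  \<comment> \<open>\<open>\<kappa> j\<close> is the index of the first list with an entry at
    position \<open>j\<close>. On the grid event it equals formation time \<open>j\<close> rounded
    up, in units of \<open>h\<close>.\<close>
  define \<kappa> where "\<kappa> j = (LEAST m. j < l m)" for j
  have \<kappa>: "j < l (\<kappa> j)" "\<kappa> j \<le> m" if "j < l m" for j m
    unfolding \<kappa>_def using that by (auto intro: LeastI Least_le)
  have \<kappa>_le: "l m \<le> j" if "m < \<kappa> j" for j m
    using not_less_Least[of m "\<lambda>m. j < l m"] that unfolding \<kappa>_def by simp
  have start: "y (\<kappa> j) ! j = 1" if j: "j < l k" for j
  proof (cases "\<kappa> j")
    case 0
    then have "j = 0" using \<kappa>(1)[OF j] l0 by simp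
    then show ?thesis using 0 y0 by simp
  next
    case (Suc m)
    then have "m < k" using \<kappa>(2)[OF j] by simp
    moreover have "l m \<le> j" using \<kappa>_le[of m j] Suc by simp
    ultimately have "j = l m" "l m < l (Suc m)" using lS(1)[of m] \<kappa>(1)[OF j] Suc by auto
    then show ?thesis using lS(2)[OF \<open>m < k\<close>] Suc by simp
  qed
  define b where "b j n = (\<Prod>i=\<kappa> j..<n. trans (Suc j) h (y i ! j) (y (Suc i) ! j))" for j n
  have b_nonneg: "b j n \<ge> 0" for j n
    unfolding b_def using h by (intro prod_nonneg) (auto intro: trans_nonneg)
  have "(\<Prod>m<n. step_weight h (y m) (y (Suc m))) \<le>
      \<P>(\<omega> in M. grid_event h l n \<omega>) * (\<Prod>j<l n. b j n)" if "n \<le> k" for n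
    using that
  proof (induction n)
    case 0
    have "AE \<omega> in M. grid_event h l 0 \<omega>"
      using AE_\<pi>_pos by eventually_elim (simp add: grid_event_def l0 formation_time_def)
    then have "\<P>(\<omega> in M. grid_event h l 0 \<omega>) = 1" by (simp add: prob_Collect_eq_1)
    moreover have "\<kappa> 0 = 0" using \<kappa>(2)[of 0 0] l0 by simp
    ultimately show ?case by (simp add: l0 b_def)
  next
    case (Suc n)
    then have n: "n < k" by simp
    \<comment> \<open>A household formed in this step has \<open>\<kappa>\<close> equal to
      \<open>Suc n\<close>, so its product of transitions is still empty.\<close>
    have "(\<Prod>j<l (Suc n). b j (Suc n)) = (\<Prod>j<l n. b j (Suc n))"
    proof (cases "l (Suc n) = l n")
      case False
      then have lSn: "l (Suc n) = Suc (l n)" using lS(1)[OF n] by simp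
      have "\<kappa> (l n) = Suc n" unfolding \<kappa>_def
      proof (rule Least_equality)
        fix m assume "l n < l m"
        then show "Suc n \<le> m" using mono[of m n] n by (meson leD le_less_linear less_or_eq_imp_le not_less_eq_eq)
      qed (simp add: lSn)
      then have "b (l n) (Suc n) = 1" by (simp add: b_def)
      then show ?thesis by (simp add: lSn)
    qed simp
    also have "\<dots> = (\<Prod>j<l n. b j n * trans (Suc j) h (y n ! j) (y (Suc n) ! j))"
    proof (rule prod.cong)
      fix j assume "j \<in> {..<l n}"
      then have "\<kappa> j \<le> n" using \<kappa>(2) by simp
      then show "b j (Suc n) = b j n * trans (Suc j) h (y n ! j) (y (Suc n) ! j)"
        by (simp add: b_def)
    qed simp
    finally have b_Suc: "(\<Prod>j<l (Suc n). b j (Suc n)) =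
        (\<Prod>j<l n. b j n) * (\<Prod>j<l n. trans (Suc j) h (y n ! j) (y (Suc n) ! j))"
      by (simp add: prod.distrib)
    have tr: "(\<Prod>j<l n. trans (Suc j) h (y n ! j) (y (Suc n) ! j)) \<ge> 0"
      using h by (intro prod_nonneg) (auto intro: trans_nonneg)
    have "(\<Prod>m<Suc n. step_weight h (y m) (y (Suc m))) \<le>
        (\<P>(\<omega> in M. grid_event h l n \<omega>) * (\<Prod>j<l n. b j n)) * step_weight h (y n) (y (Suc n))"
      using Suc h by (simp add: mult_right_mono step_weight_nonneg)
    also have "\<dots> = (\<P>(\<omega> in M. grid_event h l n \<omega>) * birth_weight h (l n) (l (Suc n))) *
        (\<Prod>j<l (Suc n). b j (Suc n))"
      unfolding lS(3)[OF n] b_Suc by simp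
    also have "\<dots> \<le> \<P>(\<omega> in M. grid_event h l (Suc n) \<omega>) * (\<Prod>j<l (Suc n). b j (Suc n))"
      using n lS(1)[OF n] h
      by (intro mult_right_mono prob_grid_event_Suc[where l = l and k = n and h = h] prod_nonneg b_nonneg)
        (auto simp: l1 mono simp del: One_nat_def)
    finally show ?case .
  qed
  then have "(\<Prod>m<k. step_weight h (y m) (y (Suc m))) \<le>
      \<P>(\<omega> in M. grid_event h l k \<omega>) * (\<Prod>j<l k. b j k)" by simp
  also have "(\<Prod>j<l k. b j k) = (\<Prod>j\<in>{1..l k}. b (j - 1) k)"
    by (rule prod.reindex_bij_witness[of _ "\<lambda>j. j - 1" Suc]) auto
  also have "\<P>(\<omega> in M. grid_event h l k \<omega>) * (\<Prod>j\<in>{1..l k}. b (j - 1) k) =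
    \<P>(\<omega> in M. grid_event h l k \<omega> \<and> (\<forall>j\<in>{1..l k}. (\<lambda>u\<in>{0..}. Z j u \<omega>) \<in>
      {z\<in>space (\<Pi>\<^sub>M u\<in>{0..}. count_space UNIV).
        \<forall>i\<le>k - \<kappa> (j - 1). z (real i * h) = y (\<kappa> (j - 1) + i) ! (j - 1)}))"
  proof (subst prob_grid_event_and_paths)
    show "{z\<in>space (\<Pi>\<^sub>M u\<in>{0..}. count_space UNIV). \<forall>i\<le>n. z (real i * h) = w i}
        \<in> sets (\<Pi>\<^sub>M u\<in>{0::real..}. count_space (UNIV :: nat set))" for n w
    proof -
      have [measurable]: "(\<lambda>z. z (real i * h)) \<in>
          (\<Pi>\<^sub>M u\<in>{0::real..}. count_space (UNIV :: nat set)) \<rightarrow>\<^sub>M count_space UNIV" for i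
        using h by (intro measurable_component_singleton) simp
      show ?thesis by measurable
    qed
    have "\<P>(\<omega> in M. (\<lambda>u\<in>{0..}. Z j u \<omega>) \<in> {z\<in>space (\<Pi>\<^sub>M u\<in>{0..}. count_space UNIV).
        \<forall>i\<le>k - \<kappa> (j - 1). z (real i * h) = y (\<kappa> (j - 1) + i) ! (j - 1)}) = b (j - 1) k"
      if j: "j \<in> {1..l k}" for j
    proof -
      have j': "j - 1 < l k" using j by auto
      have "\<P>(\<omega> in M. (\<lambda>u\<in>{0..}. Z j u \<omega>) \<in> {z\<in>space (\<Pi>\<^sub>M u\<in>{0..}. count_space UNIV).
          \<forall>i\<le>k - \<kappa> (j - 1). z (real i * h) = y (\<kappa> (j - 1) + i) ! (j - 1)}) =
        \<P>(\<omega> in M. \<forall>i\<le>k - \<kappa> (j - 1). Z j (real i * h) \<omega> = y (\<kappa> (j - 1) + i) ! (j - 1))"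
        using h by (intro arg_cong[where f = prob]) (auto simp: space_PiM)
      also have "\<dots> = (\<Prod>i<k - \<kappa> (j - 1). trans j h (y (\<kappa> (j - 1) + i) ! (j - 1))
          (y (\<kappa> (j - 1) + Suc i) ! (j - 1)))"
        using j start[OF j'] by (subst prob_Z_grid) (use h in auto)
      also have "\<dots> = b (j - 1) k"
        unfolding b_def using j
        by (subst prod.atLeastLessThan_shift_0) (simp add: atLeast0LessThan)
      finally show ?thesis .
    qed
    then show "\<P>(\<omega> in M. grid_event h l k \<omega>) * (\<Prod>j = 1..l k. b (j - 1) k) =
      \<P>(\<omega> in M. grid_event h l k \<omega>) * (\<Prod>j = 1..l k. \<P>(\<omega> in M. (\<lambda>u\<in>{0..}. Z j u \<omega>) \<in>
        {z\<in>space (\<Pi>\<^sub>M u\<in>{0..}. count_space UNIV).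
          \<forall>i\<le>k - \<kappa> (j - 1). z (real i * h) = y (\<kappa> (j - 1) + i) ! (j - 1)}))"
      by (intro arg_cong2[where f = "(*)"] prod.cong) auto
  qed (use l1[of k] in auto)
  also have "\<dots> \<le> \<P>(\<omega> in M. \<forall>m\<le>k. skeleton Z \<pi> h m \<omega> = y m)"
  proof (rule finite_measure_mono_AE)
    note measurable_skeleton[OF h, measurable]
    show "{\<omega>\<in>space M. \<forall>m\<le>k. skeleton Z \<pi> h m \<omega> = y m} \<in> events" by measurable
    show "AE \<omega> in M. \<omega> \<in> {\<omega>\<in>space M. grid_event h l k \<omega> \<and> (\<forall>j\<in>{1..l k}. (\<lambda>u\<in>{0..}. Z j u \<omega>) \<in>
      {z\<in>space (\<Pi>\<^sub>M u\<in>{0..}. count_space UNIV).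
        \<forall>i\<le>k - \<kappa> (j - 1). z (real i * h) = y (\<kappa> (j - 1) + i) ! (j - 1)})} \<longrightarrow>
      \<omega> \<in> {\<omega>\<in>space M. \<forall>m\<le>k. skeleton Z \<pi> h m \<omega> = y m}"
      using AE_\<pi>_pos
    proof eventually_elim
      case (elim \<omega>)
      let ?T = "\<lambda>k. formation_time \<pi> k \<omega>"
      have T: "?T i \<le> ?T j" if "i \<le> j" for i j
        by (rule strict_mono_leD[OF strict_mono_formation_time that]) (use elim in auto)
      show ?case
      proof safe
        fix m assume m: "m \<le> k" and g: "grid_event h l k \<omega>"
        assume paths: "\<forall>j\<in>{1..l k}. (\<lambda>u\<in>{0..}. Z j u \<omega>) \<in> {z\<in>space (\<Pi>\<^sub>M u\<in>{0..}. count_space UNIV).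
          \<forall>i\<le>k - \<kappa> (j - 1). z (real i * h) = y (\<kappa> (j - 1) + i) ! (j - 1)}"
        have hh: "households \<pi> (real m * h) \<omega> = l m"
          using households_eqI[of \<pi> \<omega> "l m - 1" "real m * h"] g m l1[OF m] elim
          by (auto simp: grid_event_def)
        show "skeleton Z \<pi> h m \<omega> = y m"
        proof (rule nth_equalityI)
          fix j assume "j < length (skeleton Z \<pi> h m \<omega>)"
          then have j: "j < l m" by (simp add: hh)
          then have jk: "j < l k" using mono[OF m] by simp
          have \<kappa>m: "\<kappa> j \<le> m" by (rule \<kappa>(2)[OF j])
          have "?T j \<le> ?T (l (\<kappa> j) - 1)"
            using \<kappa>(1)[OF j] by (intro T) auto
          also have "\<dots> \<le> real (\<kappa> j) * h" using g \<kappa>m m by (simp add: grid_event_def)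
          finally have up: "?T j \<le> real (\<kappa> j) * h" .
          \<comment> \<open>Position \<open>j\<close> was empty at the preceding grid index, so
            household \<open>j\<close> forms within the mesh interval ending at
            \<open>real (\<kappa> j) * h\<close>.\<close>
          have lo: "real (\<kappa> j) * h - h < ?T j"
          proof (cases "\<kappa> j")
            case 0
            have "?T 0 \<le> ?T j" by (rule T) simp
            then show ?thesis using 0 h by simp
          next
            case (Suc i)
            have "real i * h < ?T (l i)" using g \<kappa>m m Suc by (simp add: grid_event_def)
            also have "\<dots> \<le> ?T j"
              using \<kappa>_le[of i j] Suc by (intro T) auto
            finally show ?thesis using Suc by (simp add: algebra_simps)
          qed
          have "\<lceil>?T j / h\<rceil> = int (\<kappa> j)"
            using up lo h by (intro ceiling_unique) (simp_all add: field_simps)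
          then have "skeleton Z \<pi> h m \<omega> ! j = Z (Suc j) (real (m - \<kappa> j) * h) \<omega>"
            using j by (simp add: nth_skeleton hh)
          also have "\<dots> = y (\<kappa> j + (m - \<kappa> j)) ! j"
            using bspec[OF paths, of "Suc j"] jk m h by auto
          finally show "skeleton Z \<pi> h m \<omega> ! j = y m ! j" using \<kappa>m by simp
        qed (simp add: hh l_def)
      qed
    qed
  qed
  finally show ?thesis .
qed

end

lemma prod_steps_path:
  fixes w :: "'s \<Rightarrow> 's \<Rightarrow> real"
  assumes "y k = x"
  shows "(\<Prod>m<k + Suc n. w (if m < k then y m else if m < k + Suc n then x else x')
      (if Suc m < k then y (Suc m) else if Suc m < k + Suc n then x else x')) =
    (\<Prod>m<k. w (y m) (y (Suc m))) * w x x ^ n * w x x'"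
proof -
  define u where "u m = (if m < k then y m else x)" for m
  have *: "(\<Prod>m<k + n. w (u m) (u (Suc m))) = (\<Prod>m<k. w (y m) (y (Suc m))) * w x x ^ n" for n
  proof (induction n)
    case 0
    have "u (Suc m) = y (Suc m)" if "m < k" for m
      using that assms unfolding u_def by (cases "Suc m = k") auto
    then show ?case by (auto intro!: prod.cong simp: u_def)
  next
    case (Suc n)
    then show ?case by (simp add: u_def)
  qed
  have "(\<Prod>m<k + Suc n. w (if m < k then y m else if m < k + Suc n then x else x')
      (if Suc m < k then y (Suc m) else if Suc m < k + Suc n then x else x')) =
    (\<Prod>m<k + n. w (u m) (u (Suc m))) * w x x'"
    by (auto simp: u_def intro!: prod.cong)
  then show ?thesis by (simp add: *)
qed

section \<open>Geometric sums over the holding times\<close>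

context positive_yule_detachment
begin

text \<open>With \<open>s = step_weight h x x\<close>, the quotient \<open>s / (1 - s)\<close> is
  the sum of \<open>s ^ n\<close> over \<open>n >= 1\<close>: holding \<open>x\<close> at
  \<open>n + 1\<close> grid points costs \<open>n\<close> repetitions, and \<open>follows\<close>
  asks for at least two points. The final state costs exactly one repetition.\<close>

fun chain_weight :: "real \<Rightarrow> nat list list \<Rightarrow> real" where
  "chain_weight h [] = 1"
| "chain_weight h [x] = step_weight h x x"
| "chain_weight h (x # y # xs) =
     step_weight h x x / (1 - step_weight h x x) * step_weight h x y * chain_weight h (y # xs)"

lemma measurable_follows:
  assumes h: "h > 0"
  shows "Measurable.pred M (\<lambda>\<omega>. follows (\<lambda>k. skeleton Z \<pi> h k \<omega>) xs k)"
proof -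
  have skel [measurable]: "Measurable.pred M (\<lambda>\<omega>. skeleton Z \<pi> h k \<omega> = x)" for k x
    using measurable_sets[OF measurable_skeleton[OF h], of "{x}" k]
    by (simp add: pred_def vimage_def Int_def conj_commute)
  show ?thesis
  \<comment> \<open>The rule \<open>follows.induct\<close> also has a slot for the path. Here the
    path depends on the bound sample point, so a dummy fills the slot.\<close>
  proof (induction "\<lambda>_ :: nat. [] :: nat list" xs k rule: follows.induct)
    case (3 x y xs k)
    have [measurable]: "Measurable.pred M (\<lambda>\<omega>. follows (\<lambda>k. skeleton Z \<pi> h k \<omega>) (y # xs) (k + n))"
      if "n \<in> {2..}" for n
      using 3 that by auto
    have "Measurable.pred M (\<lambda>\<omega>. \<exists>n\<in>{2..}. (\<forall>m<n. skeleton Z \<pi> h (k + m) \<omega> = x) \<and>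
        follows (\<lambda>k. skeleton Z \<pi> h k \<omega>) (y # xs) (k + n))"
      by measurable
    then show ?case by (simp add: Bex_def)
  qed simp_all
qed

text \<open>A prescribed prefix \<open>y\<close> is carried along because
  \<open>prob_skeleton_path\<close> starts at index 0. In the induction the holding phase of the
  head is appended to the prefix, and the holding times are then summed.\<close>

lemma prob_follows:
  assumes h: "h > 0" and xs: "xs \<noteq> []" "successively (\<noteq>) xs"
    and lt1: "\<And>x. x \<in> set xs \<Longrightarrow> step_weight h x x < 1"
    and y: "y 0 = [1]" "y k = hd xs"
  shows "(\<Prod>m<k. step_weight h (y m) (y (Suc m))) * chain_weight h xs \<le>
    \<P>(\<omega> in M. (\<forall>m<k. skeleton Z \<pi> h m \<omega> = y m) \<and> follows (\<lambda>k. skeleton Z \<pi> h k \<omega>) xs k)"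
proof -
  have skel [measurable]: "Measurable.pred M (\<lambda>\<omega>. skeleton Z \<pi> h k \<omega> = x)" for k x
    using measurable_sets[OF measurable_skeleton[OF h], of "{x}" k]
    by (simp add: pred_def vimage_def Int_def conj_commute)
  note measurable_follows[OF h, measurable]
  let ?X = "\<lambda>\<omega> k. skeleton Z \<pi> h k \<omega>"
  let ?W = "step_weight h"
  show ?thesis using xs lt1 y
  proof (induction xs arbitrary: k y rule: induct_list012)
    case (2 x)
    define y' where "y' m = (if m \<le> k then y m else x)" for m
    have "(\<Prod>m<k. ?W (y m) (y (Suc m))) * chain_weight h [x] = (\<Prod>m<Suc k. ?W (y' m) (y' (Suc m)))"
      using 2 by (simp add: y'_def)
    also have "\<dots> \<le> \<P>(\<omega> in M. \<forall>m\<le>Suc k. ?X \<omega> m = y' m)"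
      by (rule prob_skeleton_path[OF h]) (use 2 in \<open>simp add: y'_def\<close>)
    also have "\<dots> \<le> \<P>(\<omega> in M. (\<forall>m<k. ?X \<omega> m = y m) \<and> follows (?X \<omega>) [x] k)"
    proof (rule finite_measure_mono)
      show "{\<omega>\<in>space M. \<forall>m\<le>Suc k. ?X \<omega> m = y' m} \<subseteq>
          {\<omega>\<in>space M. (\<forall>m<k. ?X \<omega> m = y m) \<and> follows (?X \<omega>) [x] k}"
      proof safe
        fix \<omega> m assume *: "\<forall>m\<le>Suc k. ?X \<omega> m = y' m"
        show "?X \<omega> m = y m" if "m < k" using *[rule_format, of m] that by (simp add: y'_def)
        show "follows (?X \<omega>) [x] k"
          using *[rule_format, of k] *[rule_format, of "Suc k"] 2 by (simp add: y'_def)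
      qed
    qed measurable
    finally show ?case .
  next
    case (3 x x' xs)
    define s where "s = ?W x x"
    have s: "0 \<le> s" "s < 1" unfolding s_def using 3(5) h by (auto intro: step_weight_nonneg)
    define c where "c = (\<Prod>m<k. ?W (y m) (y (Suc m)))"
    define V where "V = chain_weight h (x' # xs)"
    have yk: "y k = x" using 3 by simp
    have xx': "x \<noteq> x'" using 3 by simp
    define z where "z n m = (if m < k then y m else if m < k + n then x else x')" for n m
    \<comment> \<open>On \<open>E n\<close> the state \<open>x\<close> is held at exactly
      \<open>n + 2\<close> grid points. The events are disjoint, since a shorter holding time shows
      \<open>x'\<close> where a longer one still shows \<open>x\<close>; their lower bounds form a
      geometric series.\<close>
    define E where "E n = {\<omega>\<in>space M. (\<forall>m<k + Suc (Suc n). ?X \<omega> m = z (Suc (Suc n)) m) \<and>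
      follows (?X \<omega>) (x' # xs) (k + Suc (Suc n))}" for n
    define F where "F = {\<omega>\<in>space M. (\<forall>m<k. ?X \<omega> m = y m) \<and> follows (?X \<omega>) (x # x' # xs) k}"
    have [measurable]: "E n \<in> events" "F \<in> events" for n unfolding E_def F_def by measurable
    have E_ge: "c * (s * s ^ n) * ?W x x' * V \<le> prob (E n)" for n
    proof -
      have "z (Suc (Suc n)) 0 = [1]" using 3(6) yk by (cases "k = 0") (auto simp: z_def)
      moreover have "z (Suc (Suc n)) (k + Suc (Suc n)) = hd (x' # xs)" by (simp add: z_def)
      ultimately have "(\<Prod>m<k + Suc (Suc n). ?W (z (Suc (Suc n)) m) (z (Suc (Suc n)) (Suc m))) * V \<le> prob (E n)"
        unfolding E_def V_def by (intro 3(2)) (use 3 in auto)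
      also have "(\<Prod>m<k + Suc (Suc n). ?W (z (Suc (Suc n)) m) (z (Suc (Suc n)) (Suc m))) =
          c * s ^ Suc n * ?W x x'"
        unfolding z_def c_def s_def by (rule prod_steps_path[where y = y and k = k and x = x, OF yk])
      finally show ?thesis by simp
    qed
    have disj: "disjoint_family E"
    proof -
      have "E n \<inter> E n' = {}" if "n < n'" for n n'
      proof (rule ccontr)
        assume "E n \<inter> E n' \<noteq> {}"
        then obtain \<omega> where "\<omega> \<in> E n" "\<omega> \<in> E n'" by blast
        then have 1: "follows (?X \<omega>) (x' # xs) (k + Suc (Suc n))"
          and 2: "\<And>m. m < k + Suc (Suc n') \<Longrightarrow> ?X \<omega> m = z (Suc (Suc n')) m"
          unfolding E_def by blast+
        then show False
          using follows_hd[OF 1] 2[of "k + Suc (Suc n)"] xx' that by (simp add: z_def)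
      qed
      then show ?thesis unfolding disjoint_family_on_def
        by (metis inf_commute linorder_neq_iff)
    qed
    have EF: "E n \<subseteq> F" for n
    proof
      fix \<omega> assume \<omega>: "\<omega> \<in> E n"
      have "?X \<omega> m = y m" if "m < k" for m using \<omega> that unfolding E_def z_def by auto
      moreover have "?X \<omega> (k + m) = x" if "m < Suc (Suc n)" for m
        using \<omega> that unfolding E_def z_def by auto
      moreover have "follows (?X \<omega>) (x' # xs) (k + Suc (Suc n))" using \<omega> unfolding E_def by blast
      ultimately show "\<omega> \<in> F" using \<omega> unfolding F_def E_def
        by (auto intro!: exI[of _ "Suc (Suc n)"] simp del: follows.simps(2) simp: less_Suc_eq)
    qed
    have part: "(\<Sum>n<N. s ^ n) * (c * s * ?W x x' * V) \<le> prob F" for N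
    proof -
      have "(\<Sum>n<N. s ^ n) * (c * s * ?W x x' * V) = (\<Sum>n<N. c * (s * s ^ n) * ?W x x' * V)"
        by (simp add: sum_distrib_left sum_distrib_right mult_ac)
      also have "\<dots> \<le> (\<Sum>n<N. prob (E n))" by (intro sum_mono E_ge)
      also have "\<dots> = prob (\<Union>n<N. E n)"
        using disj by (intro finite_measure_finite_Union[symmetric])
          (auto intro: disjoint_family_on_mono)
      also have "\<dots> \<le> prob F" using EF by (intro finite_measure_mono) auto
      finally show ?thesis .
    qed
    have "(\<lambda>N. (\<Sum>n<N. s ^ n) * (c * s * ?W x x' * V)) \<longlonglongrightarrow> 1 / (1 - s) * (c * s * ?W x x' * V)"
      using geometric_sums[of s] s unfolding sums_def by (intro tendsto_mult tendsto_const) auto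
    then have "1 / (1 - s) * (c * s * ?W x x' * V) \<le> prob F"
      by (rule LIMSEQ_le_const2) (use part in auto)
    then show ?case unfolding F_def c_def[symmetric] by (simp add: s_def V_def mult_ac)
  qed simp
qed

end

section \<open>Rates\<close>

text \<open>Targets of different moves differ in length, or in the direction of a change, or in the
  coordinate that changes. A truncated decrement could coincide with another target, but has weight
  0. So a nonzero value comes from a single summand.\<close>

lemma in_degree_prob_cases:
  assumes "in_degree_prob l1 l2 m2 x y \<noteq> 0"
  obtains (birth) i where "i < length x" "y = x[i := x ! i + 1]"
      "in_degree_prob l1 l2 m2 x y = real (x ! i) * l2 / total_rate l1 l2 m2 x"
    | (death) i where "i < length x" "x ! i > 0" "y = x[i := x ! i - 1]"
      "in_degree_prob l1 l2 m2 x y = real (x ! i) * m2 / total_rate l1 l2 m2 x"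
    | (formation) "y = x @ [1]"
      "in_degree_prob l1 l2 m2 x y = real (length x) * l1 / total_rate l1 l2 m2 x"
proof -
  let ?D = "total_rate l1 l2 m2 x"
  let ?b = "\<lambda>i. of_bool (y = x[i := x ! i + 1]) * (real (x ! i) * l2 / ?D)"
    and ?d = "\<lambda>i. of_bool (y = x[i := x ! i - 1]) * (real (x ! i) * m2 / ?D)"
    and ?f = "of_bool (y = x @ [1]) * (real (length x) * l1 / ?D)"
  have eq: "in_degree_prob l1 l2 m2 x y = (\<Sum>i<length x. ?b i) + (\<Sum>i<length x. ?d i) + ?f"
    by (simp add: in_degree_prob_def)
  consider i where "i < length x" "y = x[i := x ! i + 1]"
    | i where "i < length x" "x ! i > 0" "y = x[i := x ! i - 1]" | "y = x @ [1]"
  proof -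
    have "(\<exists>i<length x. ?b i \<noteq> 0) \<or> (\<exists>i<length x. ?d i \<noteq> 0) \<or> ?f \<noteq> 0"
    proof (rule ccontr)
      assume "\<not> ?thesis"
      then have "(\<Sum>i<length x. ?b i) = 0" "(\<Sum>i<length x. ?d i) = 0" "?f = 0"
        by (auto intro!: sum.neutral simp del: mult_eq_0_iff of_bool_eq_0_iff)
      then show False using assms eq by simp
    qed
    then show ?thesis using that by auto
  qed
  then show ?thesis
  proof cases
    case (1 i)
    have "?b j = (if j = i then real (x ! i) * l2 / ?D else 0)" if "j < length x" for j
    proof (cases "j = i")
      case False
      have "y ! j = x ! j" "x[j := x ! j + 1] ! j = x ! j + 1" using 1 that False by auto
      then have "y \<noteq> x[j := x ! j + 1]" by (metis add_eq_self_zero zero_neq_one)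
      then show ?thesis using False by simp
    qed (use 1 in simp)
    then have "(\<Sum>j<length x. ?b j) = real (x ! i) * l2 / ?D"
      using 1 by (simp add: sum.delta)
    moreover have "?d j = 0" if "j < length x" for j
    proof (cases "x ! j = 0")
      case False
      have "y ! j \<ge> x ! j" "x[j := x ! j - 1] ! j = x ! j - 1" using 1 that by (cases "i = j"; simp)+
      then have "y \<noteq> x[j := x ! j - 1]" using False by auto
      then show ?thesis by simp
    qed simp
    then have "(\<Sum>j<length x. ?d j) = 0" by (intro sum.neutral) auto
    moreover have "y \<noteq> x @ [1]" using 1 by (metis length_append_singleton length_list_update n_not_Suc_n)
    ultimately show ?thesis using 1 eq by (intro birth) auto
  next
    case (2 i)
    have "?d j = (if j = i then real (x ! i) * m2 / ?D else 0)" if "j < length x" for j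
    proof (cases "j = i")
      case False
      show ?thesis
      proof (cases "x ! j = 0")
        case pos: False
        have "y ! j = x ! j" "x[j := x ! j - 1] ! j = x ! j - 1" using 2 that False by auto
        then have "y \<noteq> x[j := x ! j - 1]" using pos by auto
        then show ?thesis using False by simp
      qed (use False in simp)
    qed (use 2 in simp)
    then have "(\<Sum>j<length x. ?d j) = real (x ! i) * m2 / ?D"
      using 2 by (simp add: sum.delta)
    moreover have "?b j = 0" if "j < length x" for j
    proof -
      have "y ! j \<le> x ! j" "x[j := x ! j + 1] ! j = x ! j + 1" using 2 that by (cases "i = j"; simp)+
      then have "y \<noteq> x[j := x ! j + 1]" by auto
      then show ?thesis by simp
    qed
    then have "(\<Sum>j<length x. ?b j) = 0" by (intro sum.neutral) auto
    moreover have "y \<noteq> x @ [1]" using 2 by (metis length_append_singleton length_list_update n_not_Suc_n)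
    ultimately show ?thesis using 2 eq by (intro death) auto
  next
    case 3
    then have "length y \<noteq> length x" by simp
    then have "y \<noteq> x[j := v]" for j v by auto
    then show ?thesis using 3 eq by (intro formation) auto
  qed
qed

lemma in_degree_prob_neq:
  assumes "in_degree_prob l1 l2 m2 x y \<noteq> 0"
  shows "x \<noteq> y"
  using assms
proof (cases rule: in_degree_prob_cases)
  case (birth i)
  then have "y ! i \<noteq> x ! i" by simp
  then show ?thesis by auto
next
  case (death i)
  then have "y ! i \<noteq> x ! i" by simp
  then show ?thesis by auto
qed auto

lemma has_real_derivative_prod_within:
  fixes f :: "'i \<Rightarrow> real \<Rightarrow> real"
  assumes "\<And>i. i \<in> I \<Longrightarrow> (f i has_real_derivative f' i) (at x within S)"
  shows "((\<lambda>x. \<Prod>i\<in>I. f i x) has_real_derivative (\<Sum>i\<in>I. f' i * (\<Prod>j\<in>I - {i}. f j x))) (at x within S)"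
proof -
  have "((\<lambda>x. \<Prod>i\<in>I. f i x) has_derivative (\<lambda>y. \<Sum>i\<in>I. f' i * y * (\<Prod>j\<in>I - {i}. f j x))) (at x within S)"
    using assms by (intro has_derivative_prod) (simp add: has_field_derivative_def)
  moreover have "(\<lambda>y. \<Sum>i\<in>I. f' i * y * (\<Prod>j\<in>I - {i}. f j x)) =
      (*) (\<Sum>i\<in>I. f' i * (\<Prod>j\<in>I - {i}. f j x))"
    by (simp add: fun_eq_iff sum_distrib_left mult_ac)
  ultimately show ?thesis by (simp add: has_field_derivative_def)
qed

section \<open>One-sided derivatives of the step weights at mesh zero\<close>

context positive_yule_detachment
begin

lemma trans_0: "j \<ge> 1 \<Longrightarrow> trans j 0 a b = of_bool (a = b)"
  using transition_function_trans[of j] by (simp add: transition_function_def)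

lemma trans_deriv: "j \<ge> 1 \<Longrightarrow>
    ((\<lambda>h. trans j h a b) has_real_derivative birth_death_generator l2 m2 a b) (at_right 0)"
  using generator_trans[of j] by (simp add: infinitesimal_generator_def)

text \<open>In the weight of a formation, the first factor vanishes at 0 and the second one is 1
  there, so the extra demand on the next waiting time does not affect the rate.\<close>

lemma birth_weight_deriv:
  "((\<lambda>h. birth_weight h n n) has_real_derivative - real n * l1) (at_right 0)"
  "((\<lambda>h. birth_weight h n (Suc n)) has_real_derivative real n * l1) (at_right 0)"
  unfolding birth_weight_def by (auto intro!: derivative_eq_intros)

lemma birth_weight_0: "birth_weight 0 n n = 1" "birth_weight 0 n (Suc n) = 0"
  by (simp_all add: birth_weight_def)

lemma prod_trans_deriv:
  "((\<lambda>h. \<Prod>j<n. trans (Suc j) h (x j) (y j)) has_real_derivative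
     (\<Sum>j<n. birth_death_generator l2 m2 (x j) (y j) *
        (\<Prod>i\<in>{..<n} - {j}. of_bool (x i = y i)))) (at_right 0)"
proof -
  have "((\<lambda>h. \<Prod>j<n. trans (Suc j) h (x j) (y j)) has_real_derivative
     (\<Sum>j<n. birth_death_generator l2 m2 (x j) (y j) *
        (\<Prod>i\<in>{..<n} - {j}. trans (Suc i) 0 (x i) (y i)))) (at_right 0)"
    by (intro has_real_derivative_prod_within trans_deriv) simp
  then show ?thesis by (simp add: trans_0)
qed

text \<open>All factors are 1 at \<open>h = 0\<close>, so their derivatives add up: the formation
  rate and all birth and death rates, with negative sign.\<close>

lemma step_weight_deriv_diag:
  "((\<lambda>h. step_weight h x x) has_real_derivative - total_rate l1 l2 m2 x) (at_right 0)"
proof -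
  let ?n = "length x"
  have "((\<lambda>h. birth_weight h ?n ?n * (\<Prod>j<?n. trans (Suc j) h (x ! j) (x ! j))) has_real_derivative
      - real ?n * l1 * (\<Prod>j<?n. trans (Suc j) 0 (x ! j) (x ! j)) +
      (\<Sum>j<?n. birth_death_generator l2 m2 (x ! j) (x ! j) *
        (\<Prod>i\<in>{..<?n} - {j}. of_bool (x ! i = x ! i))) * birth_weight 0 ?n ?n) (at_right 0)"
    by (rule DERIV_mult[OF birth_weight_deriv(1) prod_trans_deriv])
  moreover have "(\<Sum>j<?n. birth_death_generator l2 m2 (x ! j) (x ! j)) = - (l2 + m2) * real (sum_list x)"
  proof -
    have "(\<Sum>j<?n. birth_death_generator l2 m2 (x ! j) (x ! j)) = (\<Sum>j<?n. - (l2 + m2) * real (x ! j))"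
      by (intro sum.cong) (simp_all add: birth_death_generator_def algebra_simps)
    also have "\<dots> = - (l2 + m2) * (\<Sum>j<?n. real (x ! j))" by (simp only: sum_distrib_left)
    also have "(\<Sum>j<?n. real (x ! j)) = real (sum_list x)"
      by (simp add: sum_list_sum_nth atLeast0LessThan)
    finally show ?thesis .
  qed
  ultimately show ?thesis
    by (simp add: step_weight_def trans_0 birth_weight_0 total_rate_def algebra_simps)
qed

text \<open>Factor \<open>i\<close> vanishes at \<open>h = 0\<close> and all others are 1 there.
  Hence only the derivative of factor \<open>i\<close> survives the product rule.\<close>

lemma step_weight_deriv_update:
  assumes i: "i < length x" and v: "v \<noteq> x ! i"
  shows "((\<lambda>h. step_weight h x (x[i := v])) has_real_derivative
    birth_death_generator l2 m2 (x ! i) v) (at_right 0)"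
proof -
  let ?n = "length x" and ?y = "x[i := v]"
  have "((\<lambda>h. birth_weight h ?n ?n * (\<Prod>j<?n. trans (Suc j) h (x ! j) (?y ! j))) has_real_derivative
      - real ?n * l1 * (\<Prod>j<?n. trans (Suc j) 0 (x ! j) (?y ! j)) +
      (\<Sum>j<?n. birth_death_generator l2 m2 (x ! j) (?y ! j) *
        (\<Prod>i\<in>{..<?n} - {j}. of_bool (x ! i = ?y ! i))) * birth_weight 0 ?n ?n) (at_right 0)"
    by (rule DERIV_mult[OF birth_weight_deriv(1) prod_trans_deriv])
  moreover have "(\<Prod>j<?n. trans (Suc j) 0 (x ! j) (?y ! j)) = 0"
    using i v by (intro prod_zero bexI[of _ i]) (auto simp: trans_0)
  moreover have "(\<Sum>j<?n. birth_death_generator l2 m2 (x ! j) (?y ! j) *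
        (\<Prod>i\<in>{..<?n} - {j}. of_bool (x ! i = ?y ! i))) =
      (\<Sum>j<?n. if j = i then birth_death_generator l2 m2 (x ! i) v else 0)"
  proof (rule sum.cong)
    fix j assume "j \<in> {..<?n}"
    show "birth_death_generator l2 m2 (x ! j) (?y ! j) *
        (\<Prod>i\<in>{..<?n} - {j}. of_bool (x ! i = ?y ! i)) =
      (if j = i then birth_death_generator l2 m2 (x ! i) v else 0)"
    proof (cases "j = i")
      case True
      then have "(\<Prod>i\<in>{..<?n} - {j}. of_bool (x ! i = ?y ! i)) = (1::real)"
        by (intro prod.neutral) auto
      then show ?thesis using True i by simp
    next
      case False
      then have "(\<Prod>i\<in>{..<?n} - {j}. of_bool (x ! i = ?y ! i)) = (0::real)"
        using i v by (intro prod_zero bexI[of _ i]) auto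
      then show ?thesis using False by simp
    qed
  qed simp
  ultimately show ?thesis
    using i by (simp add: step_weight_def birth_weight_0)
qed

lemma step_weight_deriv_append:
  "((\<lambda>h. step_weight h x (x @ [1])) has_real_derivative real (length x) * l1) (at_right 0)"
proof -
  let ?n = "length x"
  have "((\<lambda>h. birth_weight h ?n (Suc ?n) * (\<Prod>j<?n. trans (Suc j) h (x ! j) (x ! j))) has_real_derivative
      real ?n * l1 * (\<Prod>j<?n. trans (Suc j) 0 (x ! j) (x ! j)) +
      (\<Sum>j<?n. birth_death_generator l2 m2 (x ! j) (x ! j) *
        (\<Prod>i\<in>{..<?n} - {j}. of_bool (x ! i = x ! i))) * birth_weight 0 ?n (Suc ?n)) (at_right 0)"
    by (rule DERIV_mult[OF birth_weight_deriv(2) prod_trans_deriv])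
  then show ?thesis by (simp add: step_weight_def trans_0 birth_weight_0 nth_append)
qed

lemma step_weight_0: "step_weight 0 x x = 1"
  by (simp add: step_weight_def birth_weight_0 trans_0)

lemma total_rate_pos: "x \<in> states \<Longrightarrow> total_rate l1 l2 m2 x > 0"
  using l1 l2 m2 unfolding total_rate_def states_def
  by (intro add_nonneg_pos) auto

text \<open>The weight vanishes at \<open>h = 0\<close>, so the limit of its quotient by
  \<open>h\<close> is its derivative. Multiplying by the total rate undoes the normalisation in
  \<open>in_degree_prob\<close>.\<close>

lemma step_weight_rate:
  assumes x: "x \<in> states" and xy: "in_degree_prob l1 l2 m2 x y \<noteq> 0"
  shows "((\<lambda>h. step_weight h x y / h) \<longlongrightarrow> in_degree_prob l1 l2 m2 x y * total_rate l1 l2 m2 x)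
    (at_right 0)"
proof -
  have D: "total_rate l1 l2 m2 x \<noteq> 0" using total_rate_pos[OF x] by simp
  have xney: "step_weight 0 x y = 0"
    using xy
  proof (cases rule: in_degree_prob_cases)
    case (birth i)
    then have "(\<Prod>j<length x. trans (Suc j) 0 (x ! j) (y ! j)) = 0"
      by (intro prod_zero bexI[of _ i]) (auto simp: trans_0)
    then show ?thesis by (simp add: step_weight_def)
  next
    case (death i)
    then have "(\<Prod>j<length x. trans (Suc j) 0 (x ! j) (y ! j)) = 0"
      by (intro prod_zero bexI[of _ i]) (auto simp: trans_0)
    then show ?thesis by (simp add: step_weight_def)
  qed (simp add: step_weight_def birth_weight_0)
  have "((\<lambda>h. step_weight h x y) has_real_derivative
      in_degree_prob l1 l2 m2 x y * total_rate l1 l2 m2 x) (at_right 0)"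
    using xy
  proof (cases rule: in_degree_prob_cases)
    case (birth i)
    then show ?thesis
      using step_weight_deriv_update[of i x "x ! i + 1"] D by (simp add: birth_death_generator_def)
  next
    case (death i)
    then have "birth_death_generator l2 m2 (x ! i) (x ! i - 1) = real (x ! i) * m2"
      and "x ! i - 1 \<noteq> x ! i"
      by (auto simp: birth_death_generator_def)
    then show ?thesis
      using step_weight_deriv_update[of i x "x ! i - 1"] death D by simp
  next
    case formation
    then show ?thesis using step_weight_deriv_append[of x] D by simp
  qed
  then show ?thesis by (simp add: has_field_derivative_iff xney)
qed

lemma step_weight_diag_rate:
  "((\<lambda>h. (1 - step_weight h x x) / h) \<longlongrightarrow> total_rate l1 l2 m2 x) (at_right 0)"
proof -
  have "((\<lambda>h. - ((step_weight h x x - 1) / h)) \<longlongrightarrow> - (- total_rate l1 l2 m2 x)) (at_right 0)"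
    using step_weight_deriv_diag[of x]
    by (intro tendsto_minus) (simp add: has_field_derivative_iff step_weight_0)
  then show ?thesis by (simp add: minus_divide_left)
qed

lemma step_weight_diag_tendsto: "((\<lambda>h. step_weight h x x) \<longlongrightarrow> 1) (at_right 0)"
  using DERIV_continuous[OF step_weight_deriv_diag[of x]]
  by (simp add: continuous_within step_weight_0)

lemma eventually_step_weight_less_1:
  assumes "x \<in> states"
  shows "eventually (\<lambda>h. step_weight h x x < 1) (at_right 0)"
proof -
  have "eventually (\<lambda>h. (1 - step_weight h x x) / h > 0) (at_right 0)"
    by (rule order_tendstoD(1)[OF step_weight_diag_rate total_rate_pos[OF assms]])
  moreover have "eventually (\<lambda>h::real. h > 0) (at_right 0)" by (rule eventually_at_right_less)
  ultimately show ?thesis by eventually_elim (simp add: zero_less_divide_iff)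
qed

text \<open>Dividing \<open>step_weight h x y\<close> and \<open>1 - step_weight h x x\<close> by
  \<open>h\<close> exhibits a ratio of rates. The total rate cancels and leaves the jump
  probability.\<close>

lemma step_weight_ratio:
  assumes x: "x \<in> states" and xy: "in_degree_prob l1 l2 m2 x y \<noteq> 0"
  shows "((\<lambda>h. step_weight h x x / (1 - step_weight h x x) * step_weight h x y) \<longlongrightarrow>
    in_degree_prob l1 l2 m2 x y) (at_right 0)"
proof -
  have D: "total_rate l1 l2 m2 x \<noteq> 0" using total_rate_pos[OF x] by simp
  have lim: "((\<lambda>h. step_weight h x x * ((step_weight h x y / h) / ((1 - step_weight h x x) / h))) \<longlongrightarrow>
      1 * ((in_degree_prob l1 l2 m2 x y * total_rate l1 l2 m2 x) / total_rate l1 l2 m2 x)) (at_right 0)"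
    by (intro tendsto_mult tendsto_divide step_weight_diag_tendsto step_weight_rate
        step_weight_diag_rate x xy D)
  have ev: "eventually (\<lambda>h. step_weight h x x *
      ((step_weight h x y / h) / ((1 - step_weight h x x) / h)) =
      step_weight h x x / (1 - step_weight h x x) * step_weight h x y) (at_right 0)"
    using eventually_at_right_less[of "0::real"] by eventually_elim simp
  show ?thesis using Lim_transform_eventually[OF lim ev] D by simp
qed

end

section \<open>The census chain\<close>

text \<open>Countable additivity extends the bound to all sets. Applied to a set and to its
  complement, it must be an equality because both total masses are 1.\<close>

lemma prob_measure_eqI_singletons:
  fixes P Q :: "'s :: countable measure"
  assumes P: "prob_space P" "sets P = UNIV" and Q: "prob_space Q" "sets Q = UNIV"
    and le: "\<And>x. emeasure P {x} \<le> emeasure Q {x}"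
  shows "P = Q"
proof (rule measure_eqI)
  have PQ: "emeasure P A \<le> emeasure Q A" for A
  proof -
    have "emeasure P A = (\<integral>\<^sup>+x. emeasure P {x} \<partial>count_space A)"
      using P by (intro emeasure_countable_singleton) auto
    also have "\<dots> \<le> (\<integral>\<^sup>+x. emeasure Q {x} \<partial>count_space A)"
      by (intro nn_integral_mono le)
    also have "\<dots> = emeasure Q A"
      using Q by (intro emeasure_countable_singleton[symmetric]) auto
    finally show ?thesis .
  qed
  fix A
  interpret P: prob_space P by fact
  interpret Q: prob_space Q by fact
  have sp: "space P = UNIV" "space Q = UNIV"
    using sets.space_closed[of P] sets.space_closed[of Q] P Q by (auto dest: sets.sets_into_space)
  have "P.prob A \<le> Q.prob A" "P.prob (- A) \<le> Q.prob (- A)"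
    using PQ[of A] PQ[of "- A"] by (simp_all add: P.emeasure_eq_measure Q.emeasure_eq_measure)
  moreover have "P.prob (- A) = 1 - P.prob A" "Q.prob (- A) = 1 - Q.prob A"
    using P.prob_compl[of A] Q.prob_compl[of A] P Q sp by (simp_all add: Compl_eq_Diff_UNIV)
  ultimately show "emeasure P A = emeasure Q A"
    by (simp add: P.emeasure_eq_measure Q.emeasure_eq_measure)
qed (use P Q in simp)

fun path_prob :: "real \<Rightarrow> real \<Rightarrow> real \<Rightarrow> nat list list \<Rightarrow> real" where
  "path_prob l1 l2 m2 (x # y # xs) = in_degree_prob l1 l2 m2 x y * path_prob l1 l2 m2 (y # xs)"
| "path_prob l1 l2 m2 xs = 1"

lemma path_prob_eq_prod:
  "path_prob l1 l2 m2 xs = (\<Prod>k<length xs - 1. in_degree_prob l1 l2 m2 (xs ! k) (xs ! Suc k))"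
  by (induction l1 l2 m2 xs rule: path_prob.induct) (simp_all add: prod.lessThan_Suc_shift del: prod.lessThan_Suc)

lemma successively_if_path_prob_nonzero:
  "path_prob l1 l2 m2 xs \<noteq> 0 \<Longrightarrow> successively (\<lambda>x y. in_degree_prob l1 l2 m2 x y \<noteq> 0) xs"
  by (induction l1 l2 m2 xs rule: path_prob.induct) auto

lemma (in in_degree_chain) measurable_d_UNIV [measurable]: "d t \<in> M \<rightarrow>\<^sub>M count_space UNIV"
  by (rule measurable_compose[OF measurable_d]) simp

lemma (in in_degree_chain) prob_path:
  assumes "\<And>k. k \<le> n \<Longrightarrow> x k \<in> states"
  shows "\<P>(\<omega> in M. \<forall>k\<le>n. d k \<omega> = x k) =
    of_bool (x 0 = [1]) * (\<Prod>k<n. in_degree_prob l1 l2 m2 (x k) (x (Suc k)))"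
  using assms
proof (induction n)
  case 0
  have "\<P>(\<omega> in M. d 0 \<omega> = x 0) = of_bool (x 0 = [1])"
  proof (cases "x 0 = [1]")
    case True
    then show ?thesis using start by (simp add: prob_Collect_eq_1)
  next
    case False
    then have "AE \<omega> in M. d 0 \<omega> \<noteq> x 0" using start by auto
    then show ?thesis using False by (simp add: prob_Collect_eq_0)
  qed
  then show ?case by simp
next
  case (Suc n)
  let ?P = "\<P>(\<omega> in M. \<forall>k\<le>n. d k \<omega> = x k)"
  have eq: "\<P>(\<omega> in M. \<forall>k\<le>Suc n. d k \<omega> = x k) =
      \<P>(\<omega> in M. d (Suc n) \<omega> = x (Suc n) \<and> (\<forall>k\<le>n. d k \<omega> = x k))"
    by (intro arg_cong[where f = prob]) (auto simp: le_Suc_eq)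
  have IH: "?P = of_bool (x 0 = [1]) * (\<Prod>k<n. in_degree_prob l1 l2 m2 (x k) (x (Suc k)))"
    by (rule Suc.IH) (use Suc.prems in simp)
  show ?case
  proof (cases "?P > 0")
    case True
    have "\<P>(\<omega> in M. d (Suc n) \<omega> = x (Suc n) \<bar> \<forall>k\<le>n. d k \<omega> = x k) =
        in_degree_prob l1 l2 m2 (x n) (x (Suc n))"
      by (rule markov) (use True Suc.prems in auto)
    then have "\<P>(\<omega> in M. \<forall>k\<le>Suc n. d k \<omega> = x k) = in_degree_prob l1 l2 m2 (x n) (x (Suc n)) * ?P"
      using True unfolding eq cond_prob_def by (simp add: field_simps)
    then show ?thesis unfolding IH by simp
  next
    case False
    then have P0: "?P = 0" by (intro antisym measure_nonneg) simp
    have "\<P>(\<omega> in M. \<forall>k\<le>Suc n. d k \<omega> = x k) \<le> ?P"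
      unfolding eq
    proof (intro finite_measure_mono Collect_mono impI)
      show "{\<omega>\<in>space M. \<forall>k\<le>n. d k \<omega> = x k} \<in> events" by measurable
    qed (elim conjE, intro conjI, assumption+)
    then have "\<P>(\<omega> in M. \<forall>k\<le>Suc n. d k \<omega> = x k) = 0"
      unfolding P0 by (intro antisym measure_nonneg)
    moreover have "of_bool (x 0 = [1]) * (\<Prod>k<n. in_degree_prob l1 l2 m2 (x k) (x (Suc k))) = 0"
      using IH P0 by simp
    ultimately show ?thesis by auto
  qed
qed

section \<open>Letting the mesh tend to zero\<close>

context positive_yule_detachment
begin

text \<open>\<open>chain_weight\<close> and \<open>path_prob\<close> share their recursion, so the
  limit is taken factor by factor. The additional diagonal weight of the last state tends to
  1.\<close>

lemma tendsto_chain_weight: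
  assumes "set xs \<subseteq> states" "successively (\<lambda>x y. in_degree_prob l1 l2 m2 x y \<noteq> 0) xs"
  shows "((\<lambda>h. chain_weight h xs) \<longlongrightarrow> path_prob l1 l2 m2 xs) (at_right 0)"
  using assms
proof (induction xs rule: induct_list012)
  case (2 x)
  then show ?case using step_weight_diag_tendsto by simp
next
  case (3 x y zs)
  then have "((\<lambda>h. step_weight h x x / (1 - step_weight h x x) * step_weight h x y *
      chain_weight h (y # zs)) \<longlongrightarrow> in_degree_prob l1 l2 m2 x y * path_prob l1 l2 m2 (y # zs))
      (at_right 0)"
    by (intro tendsto_mult[OF step_weight_ratio]) auto
  then show ?case by simp
qed simp

text \<open>At almost every sample point, following \<open>xs\<close> with a fine enough mesh puts
  the point into \<open>G\<close>. So the events \<open>E n\<close> lie in \<open>G\<close> up to an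
  error of vanishing probability, while their lower bounds \<open>chain_weight (h n) xs\<close>
  converge to the path probability.\<close>

lemma path_prob_le_prob_jump_chain:
  assumes xs: "xs \<noteq> []" "hd xs = [1]" "set xs \<subseteq> states"
    and succ: "successively (\<lambda>x y. in_degree_prob l1 l2 m2 x y \<noteq> 0) xs"
  shows "path_prob l1 l2 m2 xs \<le> \<P>(\<omega> in M. \<forall>m<length xs. jump_chain m \<omega> = xs ! m)"
proof -
  \<comment> \<open>Moves of nonzero probability change the state, which makes \<open>xs\<close>
    comparable with a sequence of states at jump times.\<close>
  have dist: "successively (\<noteq>) xs"
    using succ by (rule successively_mono) (auto dest: in_degree_prob_neq)
  define h where "h n = inverse (real (Suc n))" for n
  have h: "h n > 0" for n by (simp add: h_def)
  have h_lim: "filterlim h (at_right 0) sequentially"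
    unfolding h_def[abs_def] filterlim_at
    using LIMSEQ_inverse_real_of_nat by (auto intro!: always_eventually)
  define G where "G = {\<omega>\<in>space M. \<forall>m<length xs. jump_chain m \<omega> = xs ! m}"
  define E where "E n = {\<omega>\<in>space M. follows (\<lambda>k. skeleton Z \<pi> (h n) k \<omega>) xs 0}" for n
  \<comment> \<open>The union over all finer meshes makes the error events decreasing. Their
    intersection is null by the pathwise comparison, so continuity from above applies.\<close>
  define A where "A n = (\<Union>i\<in>{n..}. E i - G)" for n
  have [measurable]: "G \<in> events" unfolding G_def by measurable
  note measurable_follows[OF h, measurable]
  have [measurable]: "E n \<in> events" for n unfolding E_def by measurable
  have A_ev[measurable]: "A n \<in> events" for n unfolding A_def by measurable
  have "AE \<omega> in M. \<omega> \<notin> (\<Inter>n. A n)"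
    using AE_\<pi>_pos AE_space
  proof eventually_elim
    case (elim \<omega>)
    obtain h0 where h0: "h0 > 0" "\<And>h. 0 < h \<Longrightarrow> h < h0 \<Longrightarrow> follows (\<lambda>k. skeleton Z \<pi> h k \<omega>) xs 0 \<Longrightarrow>
        \<forall>m<length xs. xs ! m = yule_process Z \<pi> (jump_time (yule_process Z \<pi>) m \<omega>) \<omega>"
      using eventually_follows_imp_eq[OF _ _ dist, of \<pi> \<omega> Z] right_constant_Z elim by blast
    obtain n where n: "h n < h0" using reals_Archimedean[OF h0(1)] unfolding h_def by blast
    have "\<omega> \<notin> A n"
    proof
      assume "\<omega> \<in> A n"
      then obtain i where i: "i \<ge> n" "\<omega> \<in> E i" "\<omega> \<notin> G" unfolding A_def by auto
      have "h i \<le> h n" unfolding h_def using i by (intro le_imp_inverse_le) auto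
      then have "h i < h0" using n by simp
      then have "\<omega> \<in> G" using h0(2)[OF h, of i] i(2) unfolding E_def G_def jump_chain_def by auto
      then show False using i by simp
    qed
    then show ?case by blast
  qed
  then have "prob (\<Inter>n. A n) = 0" by (subst prob_eq_0) auto
  moreover have "decseq A" unfolding A_def decseq_def by force
  ultimately have A_lim: "(\<lambda>n. prob (A n)) \<longlonglongrightarrow> 0"
    using finite_Lim_measure_decseq[of A] A_ev by (simp add: image_subset_iff)
  have "eventually (\<lambda>h. \<forall>x\<in>set xs. step_weight h x x < 1) (at_right 0)"
    using xs(3) by (intro eventually_ball_finite) (auto intro: eventually_step_weight_less_1)
  then have ev: "eventually (\<lambda>n. \<forall>x\<in>set xs. step_weight (h n) x x < 1) sequentially"
    by (rule eventually_compose_filterlim[OF _ h_lim])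
  have "path_prob l1 l2 m2 xs \<le> prob G + 0"
  proof (rule tendsto_le[OF _ tendsto_add[OF tendsto_const A_lim]
        filterlim_compose[OF tendsto_chain_weight[OF xs(3) succ] h_lim]])
    show "eventually (\<lambda>n. chain_weight (h n) xs \<le> prob G + prob (A n)) sequentially"
      using ev
    proof eventually_elim
      case (elim n)
      \<comment> \<open>At \<open>k = 0\<close> the product over the prefix is empty; the constant
        path only supplies the starting value \<open>[1]\<close>.\<close>
      have "chain_weight (h n) xs \<le> prob (E n)"
        using prob_follows[OF h xs(1) dist, of n "\<lambda>_. [1]" 0] elim xs(2) unfolding E_def by simp
      also have "\<dots> \<le> prob (G \<union> A n)" unfolding A_def by (intro finite_measure_mono) auto
      also have "\<dots> \<le> prob G + prob (A n)" by (rule measure_Un_le) auto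
      finally show ?case .
    qed
  qed simp
  then show ?thesis unfolding G_def by simp
qed

end

text \<open>A cylinder over \<open>J\<close> is decided by the coordinates up to \<open>n\<close>.
  Reading these as one list moves the question from the product space to a countable space.\<close>

lemma emeasure_distr_cylinder:
  fixes f :: "nat \<Rightarrow> 'a \<Rightarrow> 's :: countable"
  assumes f: "(\<lambda>\<omega> t. f t \<omega>) \<in> K \<rightarrow>\<^sub>M (\<Pi>\<^sub>M t\<in>UNIV. count_space S)"
    and J: "finite J" and A: "\<And>j. j \<in> J \<Longrightarrow> A j \<subseteq> S" and n: "\<And>j. j \<in> J \<Longrightarrow> j \<le> n"
  shows "emeasure (distr K (\<Pi>\<^sub>M t\<in>UNIV. count_space S) (\<lambda>\<omega> t. f t \<omega>))
      (prod_emb UNIV (\<lambda>_. count_space S) J (Pi\<^sub>E J A)) =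
    emeasure (distr K (count_space UNIV) (\<lambda>\<omega>. map (\<lambda>t. f t \<omega>) [0..<Suc n]))
      {xs. \<forall>j\<in>J. xs ! j \<in> A j}"
proof -
  let ?E = "prod_emb UNIV (\<lambda>_. count_space S) J (Pi\<^sub>E J A)" and ?B = "{xs. \<forall>j\<in>J. xs ! j \<in> A j}"
  have E: "?E \<in> sets (\<Pi>\<^sub>M t\<in>UNIV. count_space S)" using J A by (intro sets_PiM_I) auto
  have nth: "map (\<lambda>t. g t) [0..<Suc n] \<in> ?B \<longleftrightarrow> (\<forall>j\<in>J. g j \<in> A j)" for g :: "nat \<Rightarrow> 's"
    using n by (simp add: less_Suc_eq_le del: upt_Suc)
  have ft: "f t \<in> K \<rightarrow>\<^sub>M count_space S" for t
    using measurable_compose[OF f measurable_component_singleton[of t]] by simp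
  have "f t \<in> K \<rightarrow>\<^sub>M count_space UNIV" for t
    by (rule measurable_compose[OF ft]) simp
  then have m: "(\<lambda>\<omega>. map (\<lambda>t. f t \<omega>) [0..<Suc n]) \<in> K \<rightarrow>\<^sub>M count_space UNIV"
    by (intro measurable_map_upt) auto
  have st: "f t \<omega> \<in> S" if "\<omega> \<in> space K" for t \<omega>
    using measurable_space[OF ft that] by simp
  have "(\<lambda>\<omega> t. f t \<omega>) -` ?E \<inter> space K = (\<lambda>\<omega>. map (\<lambda>t. f t \<omega>) [0..<Suc n]) -` ?B \<inter> space K"
  proof (intro set_eqI)
    fix \<omega>
    show "\<omega> \<in> (\<lambda>\<omega> t. f t \<omega>) -` ?E \<inter> space K \<longleftrightarrow>
        \<omega> \<in> (\<lambda>\<omega>. map (\<lambda>t. f t \<omega>) [0..<Suc n]) -` ?B \<inter> space K"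
      using st[of \<omega>] unfolding vimage_def mem_Collect_eq Int_iff nth[unfolded mem_Collect_eq]
      by (auto simp: prod_emb_def space_PiM PiE_iff)
  qed
  then show ?thesis by (simp add: emeasure_distr[OF f E] emeasure_distr[OF m] del: upt_Suc)
qed

theorem theorem2:
  fixes l1 l2 m2 :: real
    and M :: "'a measure" and d :: "nat \<Rightarrow> 'a \<Rightarrow> nat list"
    and N :: "'b measure" and Z :: "nat \<Rightarrow> real \<Rightarrow> 'b \<Rightarrow> nat" and \<pi> :: "nat \<Rightarrow> 'b \<Rightarrow> real"
  assumes "l1 > 0" and "l2 > 0" and "m2 \<ge> 0"
    and "in_degree_chain M l1 l2 m2 d"
    and "yule_detachment N l1 l2 m2 Z \<pi>"
  shows "distr N (\<Pi>\<^sub>M t\<in>UNIV. count_space states)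
           (\<lambda>\<omega> t. yule_process Z \<pi> (jump_time (yule_process Z \<pi>) t \<omega>) \<omega>) =
         distr M (\<Pi>\<^sub>M t\<in>UNIV. count_space states) (\<lambda>\<omega> t. d t \<omega>)"
proof -
  interpret d: in_degree_chain M l1 l2 m2 d by fact
  interpret yule_detachment N l1 l2 m2 Z \<pi> by fact
  interpret positive_yule_detachment N l1 l2 m2 Z \<pi> by unfold_locales fact+
  let ?S = "\<Pi>\<^sub>M t\<in>(UNIV :: nat set). count_space states"
  let ?Y = "\<lambda>\<omega> t. jump_chain t \<omega>" and ?d = "\<lambda>\<omega> t. d t \<omega>"
  have "jump_chain t \<in> N \<rightarrow>\<^sub>M restrict_space (count_space UNIV) states" for t
    by (rule measurable_restrict_space2) (auto intro: jump_chain_in_states)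
  then have "jump_chain t \<in> N \<rightarrow>\<^sub>M count_space states" for t
    by (simp add: restrict_count_space)
  then have Y: "?Y \<in> N \<rightarrow>\<^sub>M ?S" by (intro measurable_PiM_single') (auto simp: jump_chain_in_states)
  have d: "?d \<in> M \<rightarrow>\<^sub>M ?S"
    by (intro measurable_PiM_single' d.measurable_d)
       (auto intro!: measurable_space[OF d.measurable_d, simplified])
  \<comment> \<open>Prefixes are elements of a countable type, so the one-sided bound on singletons
    already identifies their laws.\<close>
  have prefixes: "distr M (count_space UNIV) (\<lambda>\<omega>. map (\<lambda>t. d t \<omega>) [0..<Suc n]) =
    distr N (count_space UNIV) (\<lambda>\<omega>. map (\<lambda>t. jump_chain t \<omega>) [0..<Suc n])" for n
  proof (rule prob_measure_eqI_singletons)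
    have dn[measurable]: "(\<lambda>\<omega>. map (\<lambda>t. d t \<omega>) [0..<Suc n]) \<in> M \<rightarrow>\<^sub>M count_space UNIV"
      by (intro measurable_map_upt) auto
    have Yn[measurable]: "(\<lambda>\<omega>. map (\<lambda>t. jump_chain t \<omega>) [0..<Suc n]) \<in> N \<rightarrow>\<^sub>M count_space UNIV"
      by (intro measurable_map_upt) auto
    show "prob_space (distr M (count_space UNIV) (\<lambda>\<omega>. map (\<lambda>t. d t \<omega>) [0..<Suc n]))"
      by (rule d.prob_space_distr[OF dn])
    show "prob_space (distr N (count_space UNIV) (\<lambda>\<omega>. map (\<lambda>t. jump_chain t \<omega>) [0..<Suc n]))"
      by (rule prob_space_distr[OF Yn])
    fix xs :: "nat list list"
    have M_eq: "emeasure (distr M (count_space UNIV) (\<lambda>\<omega>. map (\<lambda>t. d t \<omega>) [0..<Suc n])) {xs} =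
        ennreal (d.prob {\<omega>\<in>space M. map (\<lambda>t. d t \<omega>) [0..<Suc n] = xs})"
      by (subst emeasure_distr[OF dn])
         (auto simp: d.emeasure_eq_measure vimage_def Int_def conj_commute simp del: upt_Suc)
    have N_eq: "emeasure (distr N (count_space UNIV) (\<lambda>\<omega>. map (\<lambda>t. jump_chain t \<omega>) [0..<Suc n])) {xs} =
        ennreal (prob {\<omega>\<in>space N. map (\<lambda>t. jump_chain t \<omega>) [0..<Suc n] = xs})"
      by (subst emeasure_distr[OF Yn])
         (auto simp: emeasure_eq_measure vimage_def Int_def conj_commute simp del: upt_Suc)
    have map_eq: "map (\<lambda>t. f t) [0..<Suc n] = xs \<longleftrightarrow> length xs = Suc n \<and> (\<forall>t\<le>n. f t = xs ! t)"
      for f :: "nat \<Rightarrow> nat list"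
    proof -
      have "map f [0..<Suc n] ! t = f t" if "t < Suc n" for t
        using that by (simp add: nth_map_upt del: upt_Suc)
      moreover have "map f [0..<Suc n] = xs \<longleftrightarrow>
          Suc n = length xs \<and> (\<forall>t<Suc n. map f [0..<Suc n] ! t = xs ! t)"
        by (simp only: list_eq_iff_nth_eq length_map length_upt diff_zero)
      ultimately show ?thesis by (metis less_Suc_eq_le)
    qed
    have "d.prob {\<omega>\<in>space M. map (\<lambda>t. d t \<omega>) [0..<Suc n] = xs} \<le>
        prob {\<omega>\<in>space N. map (\<lambda>t. jump_chain t \<omega>) [0..<Suc n] = xs}"
    proof (cases "length xs = Suc n \<and> set xs \<subseteq> states")
      case True
      then have len: "length xs = Suc n" and st: "set xs \<subseteq> states" by auto
      then have ne: "xs \<noteq> []" and hd: "hd xs = xs ! 0" by (auto simp: hd_conv_nth[of xs] simp flip: length_greater_0_conv)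
      have "d.prob {\<omega>\<in>space M. map (\<lambda>t. d t \<omega>) [0..<Suc n] = xs} =
          d.prob {\<omega>\<in>space M. \<forall>k\<le>n. d k \<omega> = xs ! k}"
        by (simp only: map_eq len simp_thms)
      also have "\<dots> = of_bool (hd xs = [1]) * path_prob l1 l2 m2 xs"
        using st len by (subst d.prob_path) (auto simp: path_prob_eq_prod hd)
      \<comment> \<open>If the head is wrong or the path probability is 0, the left side vanishes.
        Otherwise every single transition has nonzero probability, as the limit argument
        assumes.\<close>
      also have "\<dots> \<le> prob {\<omega>\<in>space N. \<forall>m<length xs. jump_chain m \<omega> = xs ! m}"
      proof (cases "hd xs = [1] \<and> path_prob l1 l2 m2 xs \<noteq> 0")
        case True
        then show ?thesis
          using path_prob_le_prob_jump_chain[OF ne _ st successively_if_path_prob_nonzero] by simp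
      qed auto
      also have "\<dots> = prob {\<omega>\<in>space N. map (\<lambda>t. jump_chain t \<omega>) [0..<Suc n] = xs}"
        by (simp only: map_eq len simp_thms less_Suc_eq_le)
      finally show ?thesis .
    next
      case False
      \<comment> \<open>\<open>d\<close> takes values in \<open>states\<close> at every sample
        point, so lists with other entries or another length never occur and the bound is
        trivial.\<close>
      have "{\<omega>\<in>space M. map (\<lambda>t. d t \<omega>) [0..<Suc n] = xs} = {}"
      proof (rule ccontr)
        assume "\<not> ?thesis"
        then obtain \<omega> where \<omega>: "\<omega> \<in> space M" "map (\<lambda>t. d t \<omega>) [0..<Suc n] = xs" by blast
        have "d t \<omega> \<in> states" for t using measurable_space[OF d.measurable_d \<omega>(1)] by simp
        then have "length xs = Suc n \<and> set xs \<subseteq> states" unfolding \<omega>(2)[symmetric] by auto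
        then show False using False by simp
      qed
      then show ?thesis by (simp only: measure_empty measure_nonneg)
    qed
    then show "emeasure (distr M (count_space UNIV) (\<lambda>\<omega>. map (\<lambda>t. d t \<omega>) [0..<Suc n])) {xs} \<le>
        emeasure (distr N (count_space UNIV) (\<lambda>\<omega>. map (\<lambda>t. jump_chain t \<omega>) [0..<Suc n])) {xs}"
      unfolding M_eq N_eq by (rule ennreal_leI)
  qed simp_all
  \<comment> \<open>Cylinders over finite index sets determine a finite measure on the product
    space, and each is decided by a long enough prefix.\<close>
  have "distr N ?S ?Y = distr M ?S ?d"
  proof (rule measure_eqI_PiM_infinite)
    fix A :: "nat \<Rightarrow> nat list set" and J :: "nat set"
    assume J: "finite J" and A: "\<And>j. j \<in> J \<Longrightarrow> A j \<in> sets (count_space states)"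
    let ?E = "prod_emb UNIV (\<lambda>_. count_space states) J (Pi\<^sub>E J A)"
    obtain n where n: "\<And>j. j \<in> J \<Longrightarrow> j \<le> n" using J finite_nat_set_iff_bounded_le by auto
    show "emeasure (distr N ?S ?Y) ?E = emeasure (distr M ?S ?d) ?E"
      using A by (simp only: emeasure_distr_cylinder[OF Y J _ n] emeasure_distr_cylinder[OF d J _ n]
          prefixes sets_count_space Pow_iff)
  next
    show "finite_measure (distr N ?S ?Y)"
      by (rule prob_space.finite_measure) (rule prob_space_distr[OF Y])
  qed simp_all
  then show ?thesis by (simp add: jump_chain_def)
qed

end
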